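(* Assume that $\lambda^{(N)}\to\lambda$ as $N\to\infty$ (convergence of probability distributions), where $\lambda$ is a probability distribution on $[0,\infty)$ with $\lambda(\{0\})=0$ and $\int_0^\infty w\,\lambda(dw)<\infty$. Let $C_N$ be the search cost of the first request when the initial configuration is distributed according to the stationary distribution. Then for $0\le x<1$, $$\lim_{N\to\infty}\mathrm{P}_\infty\Big[\frac1N C_N>x\Big]=\frac{\iint_{(w,y)\in[0,\infty)\times(x,1)}w\,\mu_\infty(dw,dy)}{\int_0^\infty w\,\lambda(dw)}=\frac{\iint_{(w,t)\in[0,\infty)\times(t_0(x),\infty)}e^{-wt}\,dt\,w^2\,\lambda(dw)}{\int_0^\infty w\,\lambda(dw)}=\frac{\int_0^\infty e^{-wt_0(x)}\,w\,\lambda(dw)}{\int_0^\infty w\,\lambda(dw)}.$$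
   Context: Stochastic ranking process (continuous-time move-to-front process): for each $N$ there are items $1,\dots,N$ in a queue with positions $X^{(N)}(t)=(X^{(N)}_1(t),\dots,X^{(N)}_N(t))$, a permutation of $(1,\dots,N)$ (position $1$ is the top). Item $i$ has a jump rate $w^{(N)}_i>0$ and jumps at the points $\tau^{(N)}_{i,1}<\tau^{(N)}_{i,2}<\cdots$ of a Poisson process on $(0,\infty)$ of rate $w^{(N)}_i$; these Poisson processes are independent over $i$ and independent of the initial configuration $X^{(N)}(0)$. When an item jumps it is moved to position $1$, every item that was above it (smaller position) moves down by one position, and all other items keep their positions. This is a Markov process on the set of permutations of $(1,\dots,N)$ and has a stationary distribution; $\mathrm{P}_\infty$ denotes probability when $X^{(N)}(0)$ has the stationary distribution. Search cost: let $Q^{(N)}_1$ be the (a.s. unique) item making the first jump after time $0$. Then $C_N=X^{(N)}_{Q^{(N)}_1}(0)$, i.e. the position of the first jumping item just before its jump. Empirical distribution of jump rates: $\lambda^{(N)}=\frac1N\sum_{i=1}^N\delta_{w^{(N)}_i}$, with $\delta_c$ the unit mass at $c$. Let $y_C(t)=1-\int_0^\infty e^{-wt}\lambda(dw)$ for $t\ge0$; it is a continuous strictly increasing bijection $[0,\infty)\to[0,1)$, and $t_0:[0,1)\to[0,\infty)$ denotes its inverse. The measure $\mu_\infty$ on $[0,\infty)\times[0,1)$ is $$\mu_\infty(dw,dy)=\frac{w e^{-wt_0(y)}\,dy\,\lambda(dw)}{\int_0^\infty\tilde w e^{-\tilde w t_0(y)}\lambda(d\tilde w)}.$$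
   Formalization: Convergence of λ^(N) to λ is taken as weak convergence together with convergence of the means ∫w λ^(N)(dw) → ∫w λ(dw); with weak convergence alone the limit fails for 0<x<1, e.g. for w_1=N and w_i=1 otherwise. *)

theory Defs
  imports "HOL-Probability.Probability"
begin

section \<open>Poisson processes on the positive half line\<close>

text \<open>A point process is given by its points \<open>T 0 < T 1 < \<dots>\<close> (0-based, so \<open>T 0\<close> is the first
  point).\<close>

definition num_points :: "(nat \<Rightarrow> 'a \<Rightarrow> real) \<Rightarrow> real \<Rightarrow> real \<Rightarrow> 'a \<Rightarrow> nat" where
  "num_points T s t \<omega> = card {k. s < T k \<omega> \<and> T k \<omega> \<le> t}"

text \<open>Without the local finiteness condition (points tending to infinity) \<open>num_points\<close> would be
  \<open>0\<close> for intervals that contain infinitely many points.\<close>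

definition poisson_process :: "'a measure \<Rightarrow> real \<Rightarrow> (nat \<Rightarrow> 'a \<Rightarrow> real) \<Rightarrow> bool" where
  "poisson_process M r T \<longleftrightarrow>
     (\<forall>k. T k \<in> borel_measurable M) \<and>
     (AE \<omega> in M. 0 < T 0 \<omega> \<and> strict_mono (\<lambda>k. T k \<omega>) \<and> filterlim (\<lambda>k. T k \<omega>) at_top sequentially) \<and>
     (\<forall>s t. 0 \<le> s \<longrightarrow> s < t \<longrightarrow>
        distr M (count_space UNIV) (num_points T s t) = measure_pmf (poisson_pmf (r * (t - s)))) \<and>
     (\<forall>n u. 0 \<le> u 0 \<longrightarrow> strict_mono u \<longrightarrow>
        prob_space.indep_vars M (\<lambda>_. count_space UNIV)
          (\<lambda>j. num_points T (u j) (u (Suc j))) {..<(n::nat)})"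


section \<open>The stochastic ranking process\<close>

text \<open>A configuration \<open>x\<close> maps an item in \<open>{1..N}\<close> to its position in \<open>{1..N}\<close>; following the
  library convention for permutations it is the identity elsewhere.\<close>

definition configs :: "nat \<Rightarrow> (nat \<Rightarrow> nat) set" where
  "configs N = {x. x permutes {1..N}}"

definition move_to_front :: "nat \<Rightarrow> nat \<Rightarrow> (nat \<Rightarrow> nat) \<Rightarrow> nat \<Rightarrow> nat" where
  "move_to_front N i x =
     (\<lambda>j. if j = i then 1 else if j \<in> {1..N} \<and> x j < x i then x j + 1 else x j)"

text \<open>\<open>X t \<omega>\<close> is the configuration at time \<open>t \<ge> 0\<close> and \<open>\<tau> i k \<omega>\<close> is the \<open>k\<close>-th jump time
  (0-based) of item \<open>i\<close>. A path is constant on time intervals without jumps, and at a jump time of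
  item \<open>i\<close> it equals \<open>move_to_front N i\<close> of its left limit. Almost surely the jump times of all
  items are distinct and locally finite, so these conditions determine the path from \<open>X 0\<close>.\<close>

locale stochastic_ranking_process = prob_space M
  for M :: "'a measure" and N :: nat and w :: "nat \<Rightarrow> real"
    and X :: "real \<Rightarrow> 'a \<Rightarrow> (nat \<Rightarrow> nat)" and \<tau> :: "nat \<Rightarrow> nat \<Rightarrow> 'a \<Rightarrow> real" +
  assumes rate_pos: "\<And>i. i \<in> {1..N} \<Longrightarrow> 0 < w i"
    and poisson: "\<And>i. i \<in> {1..N} \<Longrightarrow> poisson_process M (w i) (\<tau> i)"
    and indep_items:
      "indep_vars (\<lambda>_. Pi\<^sub>M UNIV (\<lambda>_. borel)) (\<lambda>i \<omega>. (\<lambda>k. \<tau> i k \<omega>)) {1..N}"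
    and indep_initial:
      "indep_set (sets (vimage_algebra (space M) (X 0) (count_space (configs N))))
         (sets (vimage_algebra (space M) (\<lambda>\<omega>. \<lambda>i\<in>{1..N}. \<lambda>k. \<tau> i k \<omega>)
            (Pi\<^sub>M {1..N} (\<lambda>_. Pi\<^sub>M UNIV (\<lambda>_. borel)))))"
    and X_measurable: "\<And>t. 0 \<le> t \<Longrightarrow> X t \<in> measurable M (count_space (configs N))"
    and X_const: "AE \<omega> in M. \<forall>s t. 0 \<le> s \<longrightarrow> s \<le> t \<longrightarrow>
        (\<forall>i\<in>{1..N}. \<forall>k. \<tau> i k \<omega> \<notin> {s<..t}) \<longrightarrow> X t \<omega> = X s \<omega>"
    and X_jump: "AE \<omega> in M. \<forall>i\<in>{1..N}. \<forall>k.
        \<forall>\<^sub>F s in at_left (\<tau> i k \<omega>). X (\<tau> i k \<omega>) \<omega> = move_to_front N i (X s \<omega>)"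

locale stationary_ranking_process = stochastic_ranking_process +
  assumes stationary: "\<And>t. 0 \<le> t \<Longrightarrow>
      distr M (count_space (configs N)) (X t) = distr M (count_space (configs N)) (X 0)"

definition first_jumper :: "nat \<Rightarrow> (nat \<Rightarrow> nat \<Rightarrow> 'a \<Rightarrow> real) \<Rightarrow> 'a \<Rightarrow> nat" where
  "first_jumper N \<tau> \<omega> = arg_min_on (\<lambda>i. \<tau> i 0 \<omega>) {1..N}"

definition search_cost ::
    "nat \<Rightarrow> (real \<Rightarrow> 'a \<Rightarrow> (nat \<Rightarrow> nat)) \<Rightarrow> (nat \<Rightarrow> nat \<Rightarrow> 'a \<Rightarrow> real) \<Rightarrow> 'a \<Rightarrow> nat" where
  "search_cost N X \<tau> \<omega> = X 0 \<omega> (first_jumper N \<tau> \<omega>)"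


section \<open>Jump rate distributions and the limit objects\<close>

text \<open>For \<open>N \<ge> 1\<close> this is the sum of the unit masses at \<open>w 1, \<dots>, w N\<close>, divided by \<open>N\<close>.\<close>

definition empirical :: "nat \<Rightarrow> (nat \<Rightarrow> real) \<Rightarrow> real measure" where
  "empirical N w = distr (uniform_count_measure {1..N}) borel w"

definition y_C :: "real measure \<Rightarrow> real \<Rightarrow> real" where
  "y_C \<Lambda> t = 1 - (LINT w:{0..}|\<Lambda>. exp (- w * t))"

definition t_0 :: "real measure \<Rightarrow> real \<Rightarrow> real" where
  "t_0 \<Lambda> = the_inv_into {0..} (y_C \<Lambda>)"

definition mu_inf :: "real measure \<Rightarrow> (real \<times> real) measure" where
  "mu_inf \<Lambda> = density (restrict_space \<Lambda> {0..} \<Otimes>\<^sub>M restrict_space lborel {0..<1})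
     (\<lambda>(w, y). ennreal (w * exp (- w * t_0 \<Lambda> y) / (LINT v:{0..}|\<Lambda>. v * exp (- v * t_0 \<Lambda> y))))"

end

theory Submission
  imports Defs
begin

text \<open>
  Write \<open>J t\<close> for the set of items that have jumped by time \<open>t\<close>. An item that has jumped is above every item
  that has not, so at each time the items in \<open>J t\<close> occupy exactly the positions \<open>1, \<dots>, card (J t)\<close>
  (\<open>jumped_above_not_jumped\<close>, \<open>AE_jumped_on_top\<close>). Hence, if the fraction \<open>card (J t) / N\<close> is below
  \<open>x\<close>, then item \<open>i\<close> can have a position beyond \<open>x N\<close> only if it has not jumped by time \<open>t\<close>;
  if the fraction is at least \<open>x\<close>, every item that has not jumped does have such a position. Not having jumped has probability
  \<open>exp (- w i t)\<close>.

  The first jumper is independent of the initial configuration and equals \<open>i\<close> with probability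
  \<open>w i / (w 1 + \<dots> + w N)\<close> (\<open>prob_first_jump\<close>, \<open>prob_search_cost\<close>). By stationarity the position of item
  \<open>i\<close> at time \<open>0\<close> has the same law as at any fixed time \<open>t\<close>, and this equality of laws is all that is used of the stationary distribution.
  Together this bounds the tail of the search cost from both sides by
  \<open>(\<Sum>i. w i exp (- w i t)) / (\<Sum>i. w i)\<close> up to a deviation probability of \<open>card (J t)\<close>
  (\<open>prob_search_cost_le\<close>, \<open>prob_search_cost_ge\<close>).

  The number \<open>card (J t)\<close> is a sum of independent indicators, so by Hoeffding's inequality it concentrates around its mean, which
  divided by \<open>N\<close> tends to \<open>y_C t\<close> by weak convergence. Choosing \<open>t\<close> slightly below
  or above \<open>t_0 x\<close> makes the deviation probability vanish in the upper or lower bound, and the main term tends to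
  \<open>\<integral> v exp (- v t) d\<Lambda> / \<integral> v d\<Lambda>\<close>; continuity in \<open>t\<close> closes the gap (\<open>search_cost_tendsto\<close>).

  For the two double integrals, Tonelli's theorem leaves an inner integral in \<open>y\<close> or \<open>t\<close> for a fixed rate \<open>v\<close>.
  In both cases the fundamental theorem of calculus evaluates it to \<open>v exp (- v t_0 x)\<close>; for the integral in \<open>y\<close>
  this uses that \<open>t_0\<close> is the inverse of \<open>y_C\<close> and \<open>y_C' t = \<integral> v exp (- v t) d\<Lambda>\<close> is the derivative of
  \<open>y_C\<close> (\<open>mu_inf_integral\<close>, \<open>time_integral\<close>).
\<close>

section \<open>Paths: the items that have jumped occupy the top positions\<close>

text \<open>A jump moves its item to the front and never changes the relative order of the others, so an
  item that has jumped by time \<open>t\<close> stays above every item that has not. The induction is on the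
  number of jump times up to \<open>t\<close>, and goes from just before the last of them to \<open>t\<close>.\<close>

lemma jumped_above_not_jumped:
  fixes Y :: "real \<Rightarrow> nat \<Rightarrow> nat" and T :: "nat \<Rightarrow> nat \<Rightarrow> real"
  assumes perm: "\<And>t. 0 \<le> t \<Longrightarrow> Y t permutes {1..N}"
    and pos: "\<And>i. i \<in> {1..N} \<Longrightarrow> 0 < T i 0"
    and mono: "\<And>i. i \<in> {1..N} \<Longrightarrow> strict_mono (T i)"
    and loc_fin: "\<And>i. i \<in> {1..N} \<Longrightarrow> filterlim (T i) at_top sequentially"
    and const: "\<And>s t. 0 \<le> s \<Longrightarrow> s \<le> t \<Longrightarrow> \<forall>i\<in>{1..N}. \<forall>k. T i k \<notin> {s<..t} \<Longrightarrow> Y t = Y s"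
    and jump: "\<And>i k. i \<in> {1..N} \<Longrightarrow>
        \<forall>\<^sub>F s in at_left (T i k). Y (T i k) = move_to_front N i (Y s)"
  assumes t: "0 \<le> t" and i: "i \<in> {1..N}" and j: "j \<in> {1..N}" and jumped: "T j 0 \<le> t" "t < T i 0"
  shows "Y t j < Y t i"
proof -
  define D where "D t = {s. s \<le> t \<and> (\<exists>i\<in>{1..N}. \<exists>k. s = T i k)}" for t
  have T_pos: "0 < T i k" if "i \<in> {1..N}" for i k
    using pos[OF that] mono[OF that] by (metis le0 order_less_le_trans strict_mono_less_eq)
  have T_mono: "T i 0 \<le> T i k" if "i \<in> {1..N}" for i k
    using mono[OF that] by (simp add: strict_mono_less_eq)
  have fin: "finite (D t)" for t
  proof -
    have "finite {k. T i k \<le> t}" if "i \<in> {1..N}" for i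
    proof -
      have "\<forall>\<^sub>F k in sequentially. t < T i k"
        using loc_fin[OF that] by (simp add: filterlim_at_top_dense)
      then obtain n where "\<And>k. n \<le> k \<Longrightarrow> t < T i k" by (auto simp: eventually_sequentially)
      then have "{k. T i k \<le> t} \<subseteq> {..<n}" by (force simp: not_le)
      then show ?thesis using finite_subset by blast
    qed
    moreover have "D t = (\<Union>i\<in>{1..N}. T i ` {k. T i k \<le> t})" by (auto simp: D_def)
    ultimately show ?thesis by auto
  qed
  show ?thesis using t i j jumped
  proof (induction "card (D t)" arbitrary: t i j rule: less_induct)
    case less
    have "T j 0 \<in> D t" using less.prems by (auto simp: D_def)
    then have ne: "D t \<noteq> {}" by auto
    define s where "s = Max (D t)"
    have "s \<in> D t" unfolding s_def using fin ne by (rule Max_in)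
    then obtain a k where a: "a \<in> {1..N}" and s: "s = T a k" and st: "s \<le> t" by (auto simp: D_def)
    have s_max: "u \<le> s" if "u \<in> D t" for u unfolding s_def using fin that by (rule Max_ge)
    have s0: "0 < s" using T_pos[OF a] s by simp
    have "Y t = Y s"
    proof (rule const)
      show "\<forall>i\<in>{1..N}. \<forall>k. T i k \<notin> {s<..t}"
        using s_max by (fastforce simp: D_def)
    qed (use s0 st in auto)
    \<comment> \<open>Two different items cannot jump at the same time, since both would be at position 1.\<close>
    have simultaneous: "b = a" if b: "b \<in> {1..N}" and sb: "s = T b l" for b l
    proof -
      obtain r where "Y s = move_to_front N a (Y r)"
        using eventually_happens[OF jump[OF a, of k]] s by auto
      moreover have "\<forall>\<^sub>F r in at_left s. Y s = move_to_front N b (Y r)"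
        using jump[OF b, of l] unfolding sb .
      then obtain r where "Y s = move_to_front N b (Y r)"
        using eventually_happens by fastforce
      ultimately have "Y s a = 1" "Y s b = 1" by (metis move_to_front_def)+
      moreover have "inj (Y s)" using perm[of s] s0 by (simp add: permutes_inj)
      ultimately show ?thesis by (metis injD)
    qed
    \<comment> \<open>The next-to-last jump time, with value \<open>0\<close> if there is only one: any \<open>r\<close> strictly between \<open>m\<close> and \<open>s\<close> has exactly one jump time fewer.\<close>
    define m where "m = (if D t = {s} then 0 else Max (D t - {s}))"
    have m: "0 \<le> m" "m < s" "\<And>u. u \<in> D t \<Longrightarrow> u \<noteq> s \<Longrightarrow> u \<le> m"
    proof -
      have mem: "m \<in> D t - {s}" if "D t \<noteq> {s}"
        using that ne fin Max_in[of "D t - {s}"] by (auto simp: m_def)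
      show "m < s"
        using mem s_max[of m] s0 by (cases "D t = {s}") (auto simp: m_def)
      have "0 < u" if "u \<in> D t" for u using that T_pos by (auto simp: D_def)
      then show "0 \<le> m" using mem by (cases "D t = {s}") (auto simp: m_def intro: less_imp_le)
      show "u \<le> m" if "u \<in> D t" "u \<noteq> s" for u
        using that fin by (auto simp: m_def)
    qed
    have "\<forall>\<^sub>F r in at_left s. m < r \<and> r < s"
      using eventually_at_left_real[OF m(2)] by simp
    with jump[OF a, of k] have "\<forall>\<^sub>F r in at_left s. Y s = move_to_front N a (Y r) \<and> m < r \<and> r < s"
      unfolding s by (rule eventually_conj)
    then obtain r where r: "Y s = move_to_front N a (Y r)" "m < r" "r < s"
      using eventually_happens by fastforce
    have "D r \<subset> D t"
    proof -
      have "D r \<subseteq> D t" using r st by (auto simp: D_def)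
      moreover have "s \<notin> D r" using r by (auto simp: D_def)
      ultimately show ?thesis using \<open>s \<in> D t\<close> by auto
    qed
    then have card: "card (D r) < card (D t)" by (rule psubset_card_mono[OF fin])
    have r0: "0 \<le> r" using m r by simp
    have ia: "i \<noteq> a" using less.prems s st T_mono[OF a, of k] by auto
    have ri: "r < T i 0" using less.prems r st by simp
    have mem: "Y r i \<in> {1..N}" using permutes_in_image[OF perm[OF r0], of i] less.prems by blast
    have neq: "Y r i \<noteq> Y r a" using ia permutes_inj[OF perm[OF r0]] by (auto dest: injD)
    have "Y s j < Y s i"
    proof (cases "j = a")
      case True
      have "Y r a \<in> {1..N}" using permutes_in_image[OF perm[OF r0], of a] a by blast
      then show ?thesis
        using True r mem ia neq less.prems by (auto simp: move_to_front_def)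
    next
      case False
      have "T j 0 \<in> D t" using less.prems by (auto simp: D_def)
      moreover have "T j 0 \<noteq> s" using simultaneous[of j 0] False less.prems by auto
      ultimately have "T j 0 \<le> r" using m(3)[of "T j 0"] r by simp
      from less.hyps[OF card r0 _ _ this ri] less.prems have "Y r j < Y r i" by simp
      then show ?thesis
        using r False ia neq less.prems by (auto simp: move_to_front_def)
    qed
    then show ?case using \<open>Y t = Y s\<close> by simp
  qed
qed

lemma card_top_less_position:
  assumes x: "x permutes {1..N}" and J: "J \<subseteq> {1..N}" and i: "i \<in> {1..N}"
    and top: "\<And>j. j \<in> J \<Longrightarrow> x j < x i"
  shows "card J < x i"
proof -
  have "x ` J \<subseteq> {1..<x i}" using permutes_in_image[OF x] J top by fastforce
  then have "card (x ` J) \<le> x i - 1" using card_mono[of "{1..<x i}" "x ` J"] by simp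
  moreover have "card (x ` J) = card J"
    using permutes_inj[OF x] by (intro card_image) (auto simp: inj_on_def)
  moreover have "1 \<le> x i" using permutes_in_image[OF x, of i] i by simp
  ultimately show ?thesis by simp
qed

lemma position_le_card_top:
  assumes x: "x permutes {1..N}" and J: "J \<subseteq> {1..N}" and i: "i \<in> J"
    and top: "\<And>l. l \<in> {1..N} - J \<Longrightarrow> x i < x l"
  shows "x i \<le> card J"
proof -
  have "{1..x i} \<subseteq> x ` J"
  proof
    fix p assume p: "p \<in> {1..x i}"
    moreover have "x i \<in> {1..N}" using permutes_in_image[OF x, of i] i J by auto
    ultimately have "p \<in> x ` {1..N}" using permutes_image[OF x] by auto
    then obtain l where "l \<in> {1..N}" "p = x l" by auto
    then show "p \<in> x ` J" using top[of l] p by force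
  qed
  then have "card {1..x i} \<le> card (x ` J)"
    using finite_subset[OF J] by (intro card_mono) auto
  also have "\<dots> \<le> card J" using finite_subset[OF J] by (intro card_image_le) auto
  finally show ?thesis by simp
qed

section \<open>The race of the first jumps\<close>

text \<open>The first point exceeds \<open>a\<close> exactly when \<open>(0, a]\<close> contains no point. Local finiteness is what
  turns the count \<open>0\<close> into emptiness, because an infinite set has \<open>card\<close> equal to \<open>0\<close>.\<close>

lemma (in prob_space) first_point_exponential:
  assumes P: "poisson_process M r T" and r: "0 < r"
  shows "distributed M lborel (T 0) (exponential_density r)"
  unfolding exponential_distributed_iff[OF r]
proof (intro conjI allI impI)
  have T [measurable]: "T k \<in> borel_measurable M" for k
    using P by (simp add: poisson_process_def)
  show "T 0 \<in> borel_measurable M" by simp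
  have regular: "AE \<omega> in M. 0 < T 0 \<omega> \<and> strict_mono (\<lambda>k. T k \<omega>) \<and>
      filterlim (\<lambda>k. T k \<omega>) at_top sequentially"
    using P by (simp add: poisson_process_def)
  fix a :: real assume a: "0 \<le> a"
  have "prob {\<omega> \<in> space M. T 0 \<omega> > a} = exp (- r * a)"
  proof (cases "a = 0")
    case True
    have "AE \<omega> in M. T 0 \<omega> > a" using regular True by auto
    then show ?thesis using True prob_Collect_eq_1[of "\<lambda>\<omega>. T 0 \<omega> > a"] by simp
  next
    case False
    with a have a: "0 < a" by simp
    have "\<forall>n u. 0 \<le> u 0 \<longrightarrow> strict_mono u \<longrightarrow>
        indep_vars (\<lambda>_. count_space UNIV)
          (\<lambda>j. num_points T (u j) (u (Suc j))) {..<(n::nat)}"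
      using P by (simp add: poisson_process_def)
    \<comment> \<open>A single increment is already enough to obtain that the count is measurable.\<close>
    from this[rule_format, of "\<lambda>j. real j * a" "Suc 0"] a
    have "indep_vars (\<lambda>_. count_space UNIV)
        (\<lambda>j. num_points T (real j * a) (real (Suc j) * a)) {..<Suc 0}"
      by (simp add: strict_mono_def)
    then have [measurable]: "num_points T 0 a \<in> measurable M (count_space UNIV)"
      by (simp add: indep_vars_def)
    have "AE \<omega> in M. T 0 \<omega> > a \<longleftrightarrow> num_points T 0 a \<omega> = 0"
      using regular
    proof eventually_elim
      case (elim \<omega>)
      have "\<forall>\<^sub>F k in sequentially. a < T k \<omega>"
        using elim by (simp add: filterlim_at_top_dense)
      then obtain n where "\<And>k. n \<le> k \<Longrightarrow> a < T k \<omega>" by (auto simp: eventually_sequentially)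
      then have "{k. 0 < T k \<omega> \<and> T k \<omega> \<le> a} \<subseteq> {..<n}" by (force simp: not_le)
      then have fin: "finite {k. 0 < T k \<omega> \<and> T k \<omega> \<le> a}" using finite_subset by blast
      have "T 0 \<omega> \<le> T k \<omega>" for k using elim strict_mono_less_eq[of "\<lambda>k. T k \<omega>" 0 k] by simp
      then show ?case using elim fin
        by (auto simp: num_points_def not_le intro: less_le_trans)
    qed
    then have "prob {\<omega> \<in> space M. T 0 \<omega> > a} = prob {\<omega> \<in> space M. num_points T 0 a \<omega> = 0}"
      by (intro measure_eq_AE) auto
    also have "\<dots> = measure (distr M (count_space UNIV) (num_points T 0 a)) {0}"
      by (subst measure_distr) (auto intro!: arg_cong[where f=prob])
    also have "\<dots> = measure (measure_pmf (poisson_pmf (r * a))) {0}"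
      using P a unfolding poisson_process_def by fastforce
    also have "\<dots> = exp (- r * a)"
      using r a by (simp add: measure_pmf_single)
    finally show ?thesis .
  qed
  moreover have "{\<omega> \<in> space M. T 0 \<omega> \<le> a} = space M - {\<omega> \<in> space M. T 0 \<omega> > a}" by auto
  ultimately show "prob {\<omega> \<in> space M. T 0 \<omega> \<le> a} = 1 - exp (- a * r)"
    by (simp add: prob_compl mult.commute)
qed

text \<open>Conditioning on \<open>A = s\<close> leaves the integral of \<open>a exp (- a s) exp (- b s)\<close>, and this is
  \<open>a / (a + b)\<close> times the exponential density of rate \<open>a + b\<close>.\<close>

lemma (in prob_space) exponential_race:
  assumes A: "distributed M lborel A (exponential_density a)" and a: "0 < a"
    and B: "distributed M lborel B (exponential_density b)" and b: "0 < b"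
    and ind: "indep_var borel A borel B"
  shows "prob {\<omega> \<in> space M. A \<omega> < B \<omega>} = a / (a + b)"
proof -
  have [measurable]: "A \<in> borel_measurable M" "B \<in> borel_measurable M"
    using A B by (auto dest: distributed_measurable)
  have "{p \<in> space (borel \<Otimes>\<^sub>M borel). fst p < snd p} \<in> sets (borel \<Otimes>\<^sub>M (borel :: real measure))"
    by measurable
  then have [measurable]: "{p. fst p < snd p} \<in> sets (borel \<Otimes>\<^sub>M (borel :: real measure))"
    by (simp add: space_pair_measure)
  interpret B: prob_space "distr M borel B" by (rule prob_space_distr) simp
  have [measurable]: "(\<lambda>s. emeasure (distr M borel B) (Pair s -` {p. fst p < snd p})) \<in> borel_measurable borel"
    by (intro B.measurable_emeasure_Pair) simp
  have "emeasure M {\<omega> \<in> space M. A \<omega> < B \<omega>} =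
      emeasure (distr M (borel \<Otimes>\<^sub>M borel) (\<lambda>\<omega>. (A \<omega>, B \<omega>))) {p. fst p < snd p}"
    by (subst emeasure_distr) (auto intro!: arg_cong[where f="emeasure M"])
  also have "\<dots> = emeasure (distr M borel A \<Otimes>\<^sub>M distr M borel B) {p. fst p < snd p}"
    using ind by (simp add: indep_var_distribution_eq)
  also have "\<dots> = (\<integral>\<^sup>+s. emeasure (distr M borel B) (Pair s -` {p. fst p < snd p}) \<partial>distr M borel A)"
    by (intro B.emeasure_pair_measure_alt) auto
  also have "distr M borel A = distr M lborel A" by (rule distr_cong) auto
  also have "\<dots> = density lborel (exponential_density a)"
    using A by (rule distributed_distr_eq_density)
  also have "(\<integral>\<^sup>+s. emeasure (distr M borel B) (Pair s -` {p. fst p < snd p})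
        \<partial>density lborel (exponential_density a)) =
      (\<integral>\<^sup>+s. exponential_density a s * emeasure (distr M borel B) (Pair s -` {p. fst p < snd p}) \<partial>lborel)"
    by (intro nn_integral_density) (auto simp: exponential_density_nonneg a)
  also have "\<dots> = (\<integral>\<^sup>+s. ennreal (a / (a + b)) * ennreal (exponential_density (a + b) s) \<partial>lborel)"
  proof (intro nn_integral_cong)
    fix s :: real
    show "exponential_density a s * emeasure (distr M borel B) (Pair s -` {p. fst p < snd p}) =
        ennreal (a / (a + b)) * ennreal (exponential_density (a + b) s)"
    proof (cases "s < 0")
      case False
      have "emeasure (distr M borel B) (Pair s -` {p. fst p < snd p}) = emeasure M {\<omega> \<in> space M. s < B \<omega>}"
        by (subst emeasure_distr) (auto intro!: arg_cong[where f="emeasure M"])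
      also have "\<dots> = exp (- s * b)"
        using exponential_distributedD_gt[OF B _ b, of s] False by (simp add: emeasure_eq_measure)
      finally show ?thesis using a b False
        by (simp add: exponential_density_def distrib_left exp_add flip: ennreal_mult exp_add)
    qed (simp add: exponential_density_def)
  qed
  also have "\<dots> = ennreal (a / (a + b)) * emeasure (density lborel (exponential_density (a + b))) UNIV"
    by (simp add: nn_integral_cmult emeasure_density)
  also have "\<dots> = ennreal (a / (a + b))"
    using prob_space.emeasure_space_1[OF prob_space_exponential_density[of "a + b"]] a b by simp
  finally show ?thesis using a b by (simp add: emeasure_eq_measure)
qed

context stochastic_ranking_process
begin

lemma jump_time_measurable [measurable]: "i \<in> {1..N} \<Longrightarrow> \<tau> i k \<in> borel_measurable M"
  using poisson by (simp add: poisson_process_def)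

lemma first_jump_exponential:
  "i \<in> {1..N} \<Longrightarrow> distributed M lborel (\<tau> i 0) (exponential_density (w i))"
  by (intro first_point_exponential poisson rate_pos)

lemma first_jumps_indep: "indep_vars (\<lambda>_. borel) (\<lambda>i. \<tau> i 0) {1..N}"
  by (rule indep_vars_compose2[OF indep_items, where Y = "\<lambda>_ u. u 0"]) simp

text \<open>The minimum of the other first jumps is exponential with the sum of their rates, so this is a
  race of two independent exponential variables.\<close>

lemma prob_first_jump:
  assumes i: "i \<in> {1..N}"
  shows "prob {\<omega> \<in> space M. \<forall>j\<in>{1..N} - {i}. \<tau> i 0 \<omega> < \<tau> j 0 \<omega>} = w i / (\<Sum>j=1..N. w j)"
proof (cases "{1..N} - {i} = {}")
  case True
  then have "{1..N} = {i}" using i by blast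
  then show ?thesis using rate_pos[OF i] by (simp add: prob_space)
next
  case False
  let ?I = "{1..N} - {i}"
  have "distributed M lborel (\<lambda>\<omega>. Min ((\<lambda>j. \<tau> j 0 \<omega>) ` ?I)) (exponential_density (\<Sum>j\<in>?I. w j))"
    using False
    by (intro exponential_distributed_Min first_jump_exponential rate_pos
        indep_vars_subset[OF first_jumps_indep]) auto
  moreover have "0 < (\<Sum>j\<in>?I. w j)"
    using False by (intro sum_pos rate_pos) auto
  moreover have "indep_var borel (\<tau> i 0) borel (\<lambda>\<omega>. Min ((\<lambda>j. \<tau> j 0 \<omega>) ` ?I))"
    using i by (intro indep_vars_Min indep_vars_subset[OF first_jumps_indep]) auto
  ultimately have "prob {\<omega> \<in> space M. \<tau> i 0 \<omega> < Min ((\<lambda>j. \<tau> j 0 \<omega>) ` ?I)} =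
      w i / (w i + (\<Sum>j\<in>?I. w j))"
    using exponential_race[OF first_jump_exponential[OF i] rate_pos[OF i]] by blast
  also have "w i + (\<Sum>j\<in>?I. w j) = (\<Sum>j=1..N. w j)"
    using i by (simp add: sum.remove)
  finally show ?thesis using False by simp
qed

end

section \<open>The search cost for a fixed number of items\<close>

context stochastic_ranking_process
begin

definition jumped :: "real \<Rightarrow> 'a \<Rightarrow> nat set" where
  "jumped t \<omega> = {j \<in> {1..N}. \<tau> j 0 \<omega> \<le> t}"

text \<open>The dichotomy that carries the proof: a position is small for an item that has jumped and large for one
  that has not, with the number of jumped items as the common threshold. It holds at each fixed time
  and for every initial configuration.\<close>

lemma AE_jumped_on_top:
  assumes t: "0 \<le> t"
  shows "AE \<omega> in M. \<forall>i\<in>{1..N}.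
    if \<tau> i 0 \<omega> \<le> t then X t \<omega> i \<le> card (jumped t \<omega>) else card (jumped t \<omega>) < X t \<omega> i"
proof -
  have "AE \<omega> in M. \<forall>i\<in>{1..N}. 0 < \<tau> i 0 \<omega> \<and> strict_mono (\<lambda>k. \<tau> i k \<omega>) \<and>
      filterlim (\<lambda>k. \<tau> i k \<omega>) at_top sequentially"
    using poisson by (intro AE_finite_allI) (auto simp: poisson_process_def)
  then show ?thesis
    using X_const X_jump AE_space
  proof eventually_elim
    case (elim \<omega>)
    have perm: "X s \<omega> permutes {1..N}" if "0 \<le> s" for s
      using measurable_space[OF X_measurable[OF that]] elim by (auto simp: configs_def)
    have above: "X t \<omega> j < X t \<omega> i"
      if "i \<in> {1..N}" "j \<in> {1..N}" "\<tau> j 0 \<omega> \<le> t" "t < \<tau> i 0 \<omega>" for i j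
    proof (rule jumped_above_not_jumped[of "\<lambda>s. X s \<omega>" N "\<lambda>i k. \<tau> i k \<omega>"])
      show "X u \<omega> = X s \<omega>"
        if "0 \<le> s" "s \<le> u" "\<forall>i\<in>{1..N}. \<forall>k. \<tau> i k \<omega> \<notin> {s<..u}" for s u
        using elim(2) that by blast
      show "\<forall>\<^sub>F s in at_left (\<tau> i k \<omega>). X (\<tau> i k \<omega>) \<omega> = move_to_front N i (X s \<omega>)"
        if "i \<in> {1..N}" for i k
        using elim(3) that by blast
    qed (use elim(1) perm t that in blast)+
    show ?case
    proof
      fix i assume i: "i \<in> {1..N}"
      have sub: "jumped t \<omega> \<subseteq> {1..N}" by (auto simp: jumped_def)
      show "if \<tau> i 0 \<omega> \<le> t then X t \<omega> i \<le> card (jumped t \<omega>) else card (jumped t \<omega>) < X t \<omega> i"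
      proof (cases "\<tau> i 0 \<omega> \<le> t")
        case True
        then have "X t \<omega> i < X t \<omega> l" if "l \<in> {1..N} - jumped t \<omega>" for l
          using above[of l i] i that by (auto simp: jumped_def not_le)
        then show ?thesis
          using True i position_le_card_top[OF perm[OF t] sub, of i] by (simp add: jumped_def)
      next
        case False
        then have "X t \<omega> j < X t \<omega> i" if "j \<in> jumped t \<omega>" for j
          using above[of i j] i that by (simp add: jumped_def)
        then show ?thesis
          using False card_top_less_position[OF perm[OF t] sub i] by simp
      qed
    qed
  qed
qed

lemma position_measurable [measurable]:
  "0 \<le> t \<Longrightarrow> (\<lambda>\<omega>. X t \<omega> i) \<in> measurable M (count_space UNIV)"
  by (rule measurable_compose[OF X_measurable]) auto

lemma card_jumped: "card (jumped t \<omega>) = (\<Sum>j=1..N. if \<tau> j 0 \<omega> \<le> t then 1 else 0)"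
  unfolding jumped_def by (subst sum.inter_filter[symmetric]) auto

lemma card_jumped_measurable [measurable]:
  "(\<lambda>\<omega>. card (jumped t \<omega>)) \<in> measurable M (count_space UNIV)"
  unfolding card_jumped by measurable

lemma prob_not_jumped:
  assumes "i \<in> {1..N}" "0 \<le> t"
  shows "prob {\<omega> \<in> space M. t < \<tau> i 0 \<omega>} = exp (- w i * t)"
  using exponential_distributedD_gt[OF first_jump_exponential[OF assms(1)] assms(2) rate_pos[OF assms(1)]]
  by (simp add: mult.commute)

text \<open>The two bounds below reduce the law of one position to the survival probability of that item and
  a deviation of the number of jumped items. The two events are dependent, hence the union bound.\<close>

lemma prob_position_le:
  assumes i: "i \<in> {1..N}" and t: "0 \<le> t"
  shows "prob {\<omega> \<in> space M. a < real (X t \<omega> i)} \<le>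
    exp (- w i * t) + prob {\<omega> \<in> space M. a < real (card (jumped t \<omega>))}"
proof -
  have "prob {\<omega> \<in> space M. a < real (X t \<omega> i)} \<le>
      prob ({\<omega> \<in> space M. t < \<tau> i 0 \<omega>} \<union> {\<omega> \<in> space M. a < real (card (jumped t \<omega>))})"
  proof (rule finite_measure_mono_AE)
    show "AE \<omega> in M. \<omega> \<in> {\<omega> \<in> space M. a < real (X t \<omega> i)} \<longrightarrow>
        \<omega> \<in> {\<omega> \<in> space M. t < \<tau> i 0 \<omega>} \<union> {\<omega> \<in> space M. a < real (card (jumped t \<omega>))}"
      using AE_jumped_on_top[OF t]
    proof eventually_elim
      case (elim \<omega>)
      from bspec[OF elim i] show ?case by (auto split: if_splits)
    qed
  qed (use i in measurable)
  also have "\<dots> \<le> prob {\<omega> \<in> space M. t < \<tau> i 0 \<omega>} + prob {\<omega> \<in> space M. a < real (card (jumped t \<omega>))}"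
    using i by (intro measure_Un_le) measurable
  finally show ?thesis using prob_not_jumped[OF i t] by simp
qed

lemma prob_position_ge:
  assumes i: "i \<in> {1..N}" and t: "0 \<le> t"
  shows "exp (- w i * t) \<le> prob {\<omega> \<in> space M. a < real (X t \<omega> i)} +
    prob {\<omega> \<in> space M. real (card (jumped t \<omega>)) < a}"
proof -
  have "prob {\<omega> \<in> space M. t < \<tau> i 0 \<omega>} \<le>
      prob ({\<omega> \<in> space M. a < real (X t \<omega> i)} \<union> {\<omega> \<in> space M. real (card (jumped t \<omega>)) < a})"
  proof (rule finite_measure_mono_AE)
    show "AE \<omega> in M. \<omega> \<in> {\<omega> \<in> space M. t < \<tau> i 0 \<omega>} \<longrightarrow>
        \<omega> \<in> {\<omega> \<in> space M. a < real (X t \<omega> i)} \<union> {\<omega> \<in> space M. real (card (jumped t \<omega>)) < a}"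
      using AE_jumped_on_top[OF t]
    proof eventually_elim
      case (elim \<omega>)
      from bspec[OF elim i] show ?case by (auto split: if_splits)
    qed
  qed (use i t in measurable)
  also have "\<dots> \<le> prob {\<omega> \<in> space M. a < real (X t \<omega> i)} + prob {\<omega> \<in> space M. real (card (jumped t \<omega>)) < a}"
    using i t by (intro measure_Un_le) measurable
  finally show ?thesis using prob_not_jumped[OF i t] by simp
qed

text \<open>On ties the first jumper is an arbitrary choice among the minimizers. The choice depends
  on the set of minimizers only, and this set takes finitely many values.\<close>

lemma first_jumper_measurable [measurable]:
  "first_jumper N \<tau> \<in> measurable M (count_space UNIV)"
proof -
  define P where "P i \<omega> \<longleftrightarrow> i \<in> {1..N} \<and> (\<forall>j\<in>{1..N}. \<not> \<tau> j 0 \<omega> < \<tau> i 0 \<omega>)" for i \<omega>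
  have P [measurable]: "Measurable.pred M (P i)" for i
    unfolding P_def by measurable
  have "(\<lambda>\<omega>. {i. P i \<omega>}) \<in> measurable M (count_space (Pow {1..N}))"
  proof (subst measurable_count_space_eq2, simp, intro conjI ballI funcsetI)
    fix S assume "S \<in> Pow {1..N}"
    then have "{i. P i \<omega>} = S \<longleftrightarrow> (\<forall>i\<in>{1..N}. P i \<omega> \<longleftrightarrow> i \<in> S)" for \<omega>
      unfolding set_eq_iff mem_Collect_eq by (metis P_def PowD subsetD)
    then have "(\<lambda>\<omega>. {i. P i \<omega>}) -` {S} \<inter> space M =
        {\<omega> \<in> space M. \<forall>i\<in>{1..N}. P i \<omega> \<longleftrightarrow> i \<in> S}"
      by (simp add: vimage_def Collect_conj_eq Int_commute)
    also have "\<dots> \<in> sets M" by measurable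
    finally show "(\<lambda>\<omega>. {i. P i \<omega>}) -` {S} \<inter> space M \<in> sets M" .
  qed (auto simp: P_def)
  from measurable_compose[OF this, of "\<lambda>S. SOME i. i \<in> S" "count_space UNIV"]
  have "(\<lambda>\<omega>. SOME i. P i \<omega>) \<in> measurable M (count_space UNIV)" by simp
  moreover have "first_jumper N \<tau> = (\<lambda>\<omega>. SOME i. P i \<omega>)"
    unfolding first_jumper_def arg_min_on_def arg_min_def is_arg_min_def P_def
    by (intro ext arg_cong[where f=Eps]) auto
  ultimately show ?thesis by simp
qed

text \<open>The first jumper is independent of the initial configuration and is item \<open>i\<close> with probability
  proportional to \<open>w i\<close>. The events \<open>A i\<close> are the strict wins; their probabilities add up to
  \<open>1\<close>, which disposes of the ties.\<close>

lemma prob_search_cost: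
  assumes N: "1 \<le> N"
  shows "prob {\<omega> \<in> space M. a < real (search_cost N X \<tau> \<omega>)} =
    (\<Sum>i=1..N. w i / (\<Sum>j=1..N. w j) * prob {\<omega> \<in> space M. a < real (X 0 \<omega> i)})"
proof -
  define A where "A i = {\<omega> \<in> space M. \<forall>j\<in>{1..N} - {i}. \<tau> i 0 \<omega> < \<tau> j 0 \<omega>}" for i
  define G where "G i = {\<omega> \<in> space M. a < real (X 0 \<omega> i)}" for i
  have A [measurable]: "A i \<in> events" if [measurable]: "i \<in> {1..N}" for i
    unfolding A_def by measurable
  have G [measurable]: "G i \<in> events" for i
    unfolding G_def by measurable
  have disj: "disjoint_family_on A {1..N}"
    unfolding disjoint_family_on_def
  proof (intro ballI impI equals0I)
    fix i j \<omega> assume "i \<in> {1..N}" "j \<in> {1..N}" "i \<noteq> j" "\<omega> \<in> A i \<inter> A j"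
    then have "\<tau> i 0 \<omega> < \<tau> j 0 \<omega>" "\<tau> j 0 \<omega> < \<tau> i 0 \<omega>" by (auto simp: A_def)
    then show False by simp
  qed
  have indep: "prob (A i \<inter> G i) = prob (A i) * prob (G i)" if i: "i \<in> {1..N}" for i
  proof -
    let ?J = "Pi\<^sub>M {1..N} (\<lambda>_. Pi\<^sub>M UNIV (\<lambda>_. borel)) :: (nat \<Rightarrow> nat \<Rightarrow> real) measure"
    have [measurable]: "(\<lambda>f. f j 0) \<in> borel_measurable ?J" if "j \<in> {1..N}" for j
      by (rule measurable_compose[OF measurable_component_singleton[OF that]
            measurable_component_singleton[of 0 UNIV]]) simp
    have C: "{f \<in> space ?J. f i 0 < f j 0} \<in> sets ?J" if [measurable]: "j \<in> {1..N}" for j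
      using i by measurable
    have *: "{f \<in> space ?J. \<forall>j\<in>{1..N} - {i}. f i 0 < f j 0} \<in> sets ?J"
      by (intro sets.sets_Collect_finite_All C) auto
    have "A i = (\<lambda>\<omega>. \<lambda>i\<in>{1..N}. \<lambda>k. \<tau> i k \<omega>) -`
        {f \<in> space ?J. \<forall>j\<in>{1..N} - {i}. f i 0 < f j 0} \<inter> space M"
      using i by (auto simp: A_def space_PiM)
    also note in_vimage_algebra[OF *]
    finally have A_mem: "A i \<in> sets (vimage_algebra (space M) (\<lambda>\<omega>. \<lambda>i\<in>{1..N}. \<lambda>k. \<tau> i k \<omega>) ?J)" .
    have "G i = X 0 -` {y \<in> configs N. a < real (y i)} \<inter> space M"
      using measurable_space[OF X_measurable[of 0]] by (auto simp: G_def)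
    also have "\<dots> \<in> sets (vimage_algebra (space M) (X 0) (count_space (configs N)))"
      by (rule in_vimage_algebra) auto
    finally show ?thesis
      using indep_setD[OF indep_initial _ A_mem] by (metis Int_commute mult.commute)
  qed
  have prob_A: "prob (A i) = w i / (\<Sum>j=1..N. w j)" if "i \<in> {1..N}" for i
    using prob_first_jump[OF that] by (simp add: A_def)
  have "0 < (\<Sum>j=1..N. w j)" using N by (intro sum_pos rate_pos) auto
  then have "(\<Sum>i=1..N. prob (A i)) = 1"
    by (simp add: prob_A flip: sum_divide_distrib)
  then have "prob (\<Union>i\<in>{1..N}. A i) = 1"
    using disj by (subst finite_measure_finite_Union) auto
  then have "AE \<omega> in M. \<omega> \<in> (\<Union>i\<in>{1..N}. A i)"
    by (intro AE_prob_1)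
  then have "AE \<omega> in M. a < real (search_cost N X \<tau> \<omega>) \<longleftrightarrow> \<omega> \<in> (\<Union>i\<in>{1..N}. A i \<inter> G i)"
    using AE_space
  proof eventually_elim
    case (elim \<omega>)
    then obtain i where i: "i \<in> {1..N}" "\<omega> \<in> A i" by auto
    have least: "\<tau> i 0 \<omega> < \<tau> j 0 \<omega>" if "j \<in> {1..N}" "j \<noteq> i" for j
      using i that by (simp add: A_def)
    have "first_jumper N \<tau> \<omega> = i"
      unfolding first_jumper_def arg_min_on_def arg_min_def is_arg_min_def
    proof (rule some_equality)
      show "i \<in> {1..N} \<and> (\<nexists>j. j \<in> {1..N} \<and> \<tau> j 0 \<omega> < \<tau> i 0 \<omega>)"
        using i least by (metis less_asym less_irrefl)
      show "l = i" if "l \<in> {1..N} \<and> (\<nexists>j. j \<in> {1..N} \<and> \<tau> j 0 \<omega> < \<tau> l 0 \<omega>)" for l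
        using i least that by blast
    qed
    moreover have "j = i" if "j \<in> {1..N}" "\<omega> \<in> A j" for j
      using i that disj unfolding disjoint_family_on_def by blast
    ultimately have "\<omega> \<in> (\<Union>i\<in>{1..N}. A i \<inter> G i) \<longleftrightarrow> \<omega> \<in> G i"
      using i by blast
    then show ?case
      using elim \<open>first_jumper N \<tau> \<omega> = i\<close> by (simp add: search_cost_def G_def)
  qed
  then have "prob {\<omega> \<in> space M. a < real (search_cost N X \<tau> \<omega>)} = prob (\<Union>i\<in>{1..N}. A i \<inter> G i)"
  proof (intro measure_eq_AE)
    have "(\<lambda>\<omega>. X 0 \<omega> (first_jumper N \<tau> \<omega>)) \<in> measurable M (count_space UNIV)"
      by (rule measurable_compose_countable[OF _ first_jumper_measurable]) simp
    then show "{\<omega> \<in> space M. a < real (search_cost N X \<tau> \<omega>)} \<in> events"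
      unfolding search_cost_def by measurable
  qed auto
  also have "\<dots> = (\<Sum>i=1..N. prob (A i \<inter> G i))"
    using disj by (intro finite_measure_finite_Union) (auto simp: disjoint_family_on_def)
  also have "\<dots> = (\<Sum>i=1..N. w i / (\<Sum>j=1..N. w j) * prob (G i))"
    by (intro sum.cong refl) (simp only: indep prob_A)
  finally show ?thesis by (simp add: G_def)
qed

end

lemma (in stationary_ranking_process) prob_position_stationary:
  assumes t: "0 \<le> t"
  shows "prob {\<omega> \<in> space M. P (X t \<omega>)} = prob {\<omega> \<in> space M. P (X 0 \<omega>)}"
proof -
  have "prob {\<omega> \<in> space M. P (X t \<omega>)} = measure (distr M (count_space (configs N)) (X t)) {y \<in> configs N. P y}"
    if "0 \<le> t" for t
    using measurable_space[OF X_measurable[OF that]] that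
    by (subst measure_distr) (auto intro!: arg_cong[where f=prob] X_measurable)
  from this[OF t] this[of 0] stationary[OF t] show ?thesis by simp
qed

context stationary_ranking_process
begin

text \<open>Stationarity enters only here: it replaces the time \<open>0\<close> by any \<open>t\<close>, and
  \<open>t\<close> can then be tuned to the level \<open>a\<close> so that the number of jumped items is close to it.\<close>

lemma prob_search_cost_stationary:
  assumes "1 \<le> N" "0 \<le> t"
  shows "prob {\<omega> \<in> space M. a < real (search_cost N X \<tau> \<omega>)} =
    (\<Sum>i=1..N. w i / (\<Sum>j=1..N. w j) * prob {\<omega> \<in> space M. a < real (X t \<omega> i)})"
  using prob_position_stationary[OF assms(2), of "\<lambda>y. a < real (y _)"] prob_search_cost[OF assms(1)]
  by simp

lemma
  assumes N: "1 \<le> N" and t: "0 \<le> t"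
  defines "E \<equiv> (\<Sum>i=1..N. w i * exp (- w i * t)) / (\<Sum>j=1..N. w j)"
  shows prob_search_cost_le: "prob {\<omega> \<in> space M. a < real (search_cost N X \<tau> \<omega>)} \<le>
      E + prob {\<omega> \<in> space M. a < real (card (jumped t \<omega>))}"
    and prob_search_cost_ge: "E - prob {\<omega> \<in> space M. real (card (jumped t \<omega>)) < a} \<le>
      prob {\<omega> \<in> space M. a < real (search_cost N X \<tau> \<omega>)}"
proof -
  let ?W = "\<Sum>j=1..N. w j"
  have W: "0 < ?W" using N by (intro sum_pos rate_pos) auto
  have mix: "(\<Sum>i=1..N. w i / ?W * (exp (- w i * t) + c)) = E + c" for c
    using W by (simp add: E_def distrib_left sum.distrib flip: sum_divide_distrib sum_distrib_right)
  have "(\<Sum>i=1..N. w i / ?W * prob {\<omega> \<in> space M. a < real (X t \<omega> i)}) \<le>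
      (\<Sum>i=1..N. w i / ?W * (exp (- w i * t) + prob {\<omega> \<in> space M. a < real (card (jumped t \<omega>))}))"
    using W by (intro sum_mono mult_left_mono prob_position_le divide_nonneg_pos less_imp_le[OF rate_pos] t) auto
  then show "prob {\<omega> \<in> space M. a < real (search_cost N X \<tau> \<omega>)} \<le>
      E + prob {\<omega> \<in> space M. a < real (card (jumped t \<omega>))}"
    unfolding prob_search_cost_stationary[OF N t] mix .
  have "exp (- w i * t) + - prob {\<omega> \<in> space M. real (card (jumped t \<omega>)) < a} \<le>
      prob {\<omega> \<in> space M. a < real (X t \<omega> i)}" if "i \<in> {1..N}" for i
    using prob_position_ge[OF that t, of a] by simp
  then have "(\<Sum>i=1..N. w i / ?W * (exp (- w i * t) + - prob {\<omega> \<in> space M. real (card (jumped t \<omega>)) < a})) \<le>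
      (\<Sum>i=1..N. w i / ?W * prob {\<omega> \<in> space M. a < real (X t \<omega> i)})"
    using W by (intro sum_mono mult_left_mono divide_nonneg_pos less_imp_le[OF rate_pos]) auto
  then show "E - prob {\<omega> \<in> space M. real (card (jumped t \<omega>)) < a} \<le>
      prob {\<omega> \<in> space M. a < real (search_cost N X \<tau> \<omega>)}"
    unfolding prob_search_cost_stationary[OF N t] mix by simp
qed

end

context stochastic_ranking_process
begin

text \<open>The number of jumped items is a sum of independent indicators with mean \<open>m\<close>, so Hoeffding's
  inequality applies with intervals \<open>[0, 1]\<close>.\<close>

lemma
  fixes d m :: real
  assumes N: "1 \<le> N" and t: "0 \<le> t" and d: "0 \<le> d"
  defines "m \<equiv> (\<Sum>i=1..N. 1 - exp (- w i * t))"
  shows prob_card_jumped_upper: "prob {\<omega> \<in> space M. m + d * N \<le> card (jumped t \<omega>)} \<le> exp (- 2 * d\<^sup>2 * N)"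
    and prob_card_jumped_lower: "prob {\<omega> \<in> space M. card (jumped t \<omega>) \<le> m - d * N} \<le> exp (- 2 * d\<^sup>2 * N)"
proof -
  define V :: "nat \<Rightarrow> 'a \<Rightarrow> real" where "V j \<omega> = indicator {..t} (\<tau> j 0 \<omega>)" for j \<omega>
  have "expectation (V j) = 1 - exp (- w j * t)" if j: "j \<in> {1..N}" for j
  proof -
    have "expectation (V j) = expectation (indicator {\<omega> \<in> space M. \<tau> j 0 \<omega> \<le> t})"
      by (intro Bochner_Integration.integral_cong) (auto simp: V_def split: split_indicator)
    also have "\<dots> = prob {\<omega> \<in> space M. \<tau> j 0 \<omega> \<le> t}"
      using j by simp
    also have "\<dots> = 1 - exp (- w j * t)"
      using exponential_distributedD_le[OF first_jump_exponential[OF j] t rate_pos[OF j]]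
      by (simp add: mult.commute)
    finally show ?thesis .
  qed
  then have m: "m = (\<Sum>j=1..N. expectation (V j))" by (simp add: m_def)
  interpret Hoeffding_ineq M "{1..N}" V "\<lambda>_. 0" "\<lambda>_. 1" m
  proof unfold_locales
    show "indep_vars (\<lambda>_. borel) V {1..N}"
      unfolding V_def by (rule indep_vars_compose2[OF first_jumps_indep]) simp
    show "AE \<omega> in M. V i \<omega> \<in> {0..1}" for i by (auto simp: V_def split: split_indicator)
  qed (simp_all add: m)
  have sum: "(\<Sum>j=1..N. V j \<omega>) = card (jumped t \<omega>)" for \<omega>
    unfolding card_jumped of_nat_sum V_def by (intro sum.cong) (auto simp: indicator_def)
  have "- 2 * (d * N)\<^sup>2 / N = - 2 * d\<^sup>2 * N"
    using N by (simp add: power2_eq_square)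
  then show "prob {\<omega> \<in> space M. m + d * N \<le> card (jumped t \<omega>)} \<le> exp (- 2 * d\<^sup>2 * N)"
    "prob {\<omega> \<in> space M. card (jumped t \<omega>) \<le> m - d * N} \<le> exp (- 2 * d\<^sup>2 * N)"
    using Hoeffding_ineq_ge[of "d * N", unfolded sum] Hoeffding_ineq_le[of "d * N", unfolded sum] N d
    by simp_all
qed

end

section \<open>The limiting jump rate distribution\<close>

locale jump_rate_distribution = real_distribution \<Lambda> for \<Lambda> :: "real measure" +
  assumes rates_pos: "AE v in \<Lambda>. 0 < v" and finite_mean: "integrable \<Lambda> (\<lambda>v. v)"
begin

text \<open>This function is the derivative of \<open>y_C\<close> on \<open>[0, \<infinity>)\<close>, as \<open>y_C_has_derivative\<close> shows below.\<close>

definition y_C' :: "real \<Rightarrow> real" where "y_C' s = (LINT v|\<Lambda>. v * exp (- v * s))"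

lemma set_integral_nonneg_reals:
  fixes f :: "real \<Rightarrow> real"
  assumes [measurable]: "f \<in> borel_measurable borel"
  shows "(LINT v:{0..}|\<Lambda>. f v) = (LINT v|\<Lambda>. f v)"
  unfolding set_lebesgue_integral_def
  by (intro integral_cong_AE) (use rates_pos in \<open>auto simp: indicator_def\<close>)

lemma integral_pos:
  fixes f :: "real \<Rightarrow> real"
  assumes f: "integrable \<Lambda> f" and pos: "AE v in \<Lambda>. 0 < f v"
  shows "0 < (LINT v|\<Lambda>. f v)"
proof -
  have nonneg: "AE v in \<Lambda>. 0 \<le> f v" using pos by eventually_elim simp
  have "\<not> (AE v in \<Lambda>. f v = 0)"
  proof
    assume "AE v in \<Lambda>. f v = 0"
    with pos have "AE v in \<Lambda>. False" by eventually_elim simp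
    then show False by simp
  qed
  then have "(LINT v|\<Lambda>. f v) \<noteq> 0"
    using integral_nonneg_eq_0_iff_AE[OF f nonneg] by simp
  then show ?thesis using integral_nonneg_AE[OF nonneg] by simp
qed

lemma integrable_exp: "0 \<le> s \<Longrightarrow> integrable \<Lambda> (\<lambda>v. exp (- v * s))"
  by (rule integrable_const_bound[where B = 1]) (use rates_pos in \<open>auto elim!: eventually_mono\<close>)

lemma integrable_times_exp: "0 \<le> s \<Longrightarrow> integrable \<Lambda> (\<lambda>v. v * exp (- v * s))"
  by (rule Bochner_Integration.integrable_bound[OF finite_mean])
    (use rates_pos in \<open>auto simp: abs_mult elim!: eventually_mono intro!: mult_left_le\<close>)

lemma y_C_eq: "y_C \<Lambda> s = 1 - (LINT v|\<Lambda>. exp (- v * s))"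
  unfolding y_C_def by (simp add: set_integral_nonneg_reals)

lemma y_C'_pos: "0 \<le> s \<Longrightarrow> 0 < y_C' s"
  unfolding y_C'_def
  by (intro integral_pos integrable_times_exp) (use rates_pos in \<open>auto elim!: eventually_mono\<close>)

lemma y_C_strict_mono:
  assumes "0 \<le> s" "s < t"
  shows "y_C \<Lambda> s < y_C \<Lambda> t"
proof -
  have "0 < (LINT v|\<Lambda>. exp (- v * s) - exp (- v * t))"
    using assms by (intro integral_pos Bochner_Integration.integrable_diff integrable_exp)
      (use rates_pos in \<open>auto elim!: eventually_mono\<close>)
  also have "\<dots> = y_C \<Lambda> t - y_C \<Lambda> s"
    using assms by (subst Bochner_Integration.integral_diff[OF integrable_exp integrable_exp])
      (simp_all add: y_C_eq)
  finally show ?thesis by simp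
qed

lemma y_C_less_iff: "0 \<le> s \<Longrightarrow> 0 \<le> t \<Longrightarrow> y_C \<Lambda> s < y_C \<Lambda> t \<longleftrightarrow> s < t"
  using y_C_strict_mono[of s t] y_C_strict_mono[of t s] by (cases s t rule: linorder_cases) auto

lemma y_C_zero: "y_C \<Lambda> 0 = 0"
  using prob_space by (simp add: y_C_eq)

lemma y_C_less_one: "0 \<le> s \<Longrightarrow> y_C \<Lambda> s < 1"
  using integral_pos[OF integrable_exp] by (simp add: y_C_eq)

lemma y_C_tendsto_one: "((\<lambda>s. y_C \<Lambda> s) \<longlongrightarrow> 1) at_top"
proof -
  have "((\<lambda>s. LINT v|\<Lambda>. exp (- v * s)) \<longlongrightarrow> (LINT v|\<Lambda>. 0)) at_top"
  proof (rule integral_dominated_convergence_at_top[where w = "\<lambda>_. 1"])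
    show "AE v in \<Lambda>. ((\<lambda>s. exp (- v * s)) \<longlongrightarrow> 0) at_top"
      using rates_pos
    proof eventually_elim
      case (elim v)
      then have "filterlim (\<lambda>s. v * s) at_top at_top"
        by (intro filterlim_tendsto_pos_mult_at_top[OF tendsto_const] filterlim_ident)
      then show ?case
        by (intro filterlim_compose[OF exp_at_bot]) (simp add: filterlim_uminus_at_bot)
    qed
    show "\<forall>\<^sub>F s in at_top. AE v in \<Lambda>. norm (exp (- v * s)) \<le> 1"
      using eventually_ge_at_top[of 0]
      by eventually_elim (use rates_pos in \<open>auto elim!: eventually_mono\<close>)
  qed auto
  from tendsto_diff[OF tendsto_const this, of 1] show ?thesis by (simp add: y_C_eq[abs_def])
qed

lemma y_C'_continuous: "continuous_on {0..} y_C'"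
  unfolding continuous_on_sequentially
proof (intro allI ballI impI, elim conjE)
  fix u :: "nat \<Rightarrow> real" and s :: real
  assume u: "\<forall>n. u n \<in> {0..}" "u \<longlonglongrightarrow> s" "s \<in> {0..}"
  show "(y_C' \<circ> u) \<longlonglongrightarrow> y_C' s"
    unfolding y_C'_def o_def
  proof (rule integral_dominated_convergence[where w = "\<lambda>v. v"])
    show "AE v in \<Lambda>. (\<lambda>n. v * exp (- v * u n)) \<longlonglongrightarrow> v * exp (- v * s)"
      by (intro always_eventually allI tendsto_intros u)
    show "AE v in \<Lambda>. norm (v * exp (- v * u n)) \<le> v" for n
      using rates_pos
    proof eventually_elim
      case (elim v)
      then show ?case using u(1) by (simp add: abs_mult mult_left_le)
    qed
  qed (simp_all add: finite_mean)
qed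

text \<open>Differentiation under the integral sign. The finite mean supplies the dominating function
  \<open>v\<close>, since \<open>exp (- v s)\<close> is Lipschitz in \<open>s \<ge> 0\<close> with constant \<open>v\<close>. The derivative is one-sided at \<open>0\<close>.\<close>

lemma y_C_has_derivative:
  assumes s: "0 \<le> s"
  shows "(y_C \<Lambda> has_real_derivative y_C' s) (at s within {0..})"
  unfolding has_field_derivative_iff tendsto_at_iff_sequentially
proof (intro allI impI)
  fix u :: "nat \<Rightarrow> real" assume u: "\<forall>n. u n \<in> {0..} - {s}" "u \<longlonglongrightarrow> s"
  define q where "q n v = (exp (- v * s) - exp (- v * u n)) / (u n - s)" for n v
  have "(\<lambda>n. LINT v|\<Lambda>. q n v) \<longlonglongrightarrow> (LINT v|\<Lambda>. v * exp (- v * s))"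
  proof (rule integral_dominated_convergence[where w = "\<lambda>v. v"])
    show "AE v in \<Lambda>. (\<lambda>n. q n v) \<longlonglongrightarrow> v * exp (- v * s)"
    proof (intro always_eventually allI)
      fix v :: real
      have "((\<lambda>r. - exp (- v * r)) has_real_derivative v * exp (- v * s)) (at s)"
        by (auto intro!: derivative_eq_intros)
      then have "((\<lambda>r. (- exp (- v * r) - - exp (- v * s)) / (r - s)) \<longlongrightarrow> v * exp (- v * s)) (at s)"
        by (simp add: has_field_derivative_iff)
      with u show "(\<lambda>n. q n v) \<longlonglongrightarrow> v * exp (- v * s)"
        unfolding tendsto_at_iff_sequentially q_def by (auto simp: o_def)
    qed
    show "AE v in \<Lambda>. norm (q n v) \<le> v" for n
      using rates_pos
    proof eventually_elim
      case (elim v)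
      have lip: "\<bar>exp (- v * a) - exp (- v * b)\<bar> \<le> v * \<bar>b - a\<bar>" if "0 \<le> a" "a \<le> b" for a b
      proof -
        have "1 - v * (b - a) \<le> exp (- v * (b - a))"
          using exp_ge_add_one_self[of "- v * (b - a)"] by simp
        then have "exp (- v * a) * (1 - exp (- v * (b - a))) \<le> 1 * (v * (b - a))"
          using elim that by (intro mult_mono) auto
        also have "exp (- v * a) * (1 - exp (- v * (b - a))) = exp (- v * a) - exp (- v * b)"
          by (simp add: algebra_simps flip: exp_add)
        finally show ?thesis
          using elim that by simp
      qed
      have "0 \<le> u n" "u n \<noteq> s" using u by auto
      moreover have "\<bar>exp (- v * s) - exp (- v * u n)\<bar> \<le> v * \<bar>u n - s\<bar>"
        using lip[of s "u n"] lip[of "u n" s] s \<open>0 \<le> u n\<close>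
        by (cases "s \<le> u n") (auto simp: abs_minus_commute)
      ultimately show ?case by (simp add: q_def pos_divide_le_eq)
    qed
  qed (simp_all add: finite_mean q_def)
  moreover have "(LINT v|\<Lambda>. q n v) = (y_C \<Lambda> (u n) - y_C \<Lambda> s) / (u n - s)" for n
  proof -
    have "(LINT v|\<Lambda>. exp (- v * s) - exp (- v * u n)) = y_C \<Lambda> (u n) - y_C \<Lambda> s"
      using u s by (subst Bochner_Integration.integral_diff[OF integrable_exp integrable_exp])
        (simp_all add: y_C_eq)
    then show ?thesis by (simp add: q_def)
  qed
  ultimately show "((\<lambda>y. (y_C \<Lambda> y - y_C \<Lambda> s) / (y - s)) \<circ> u) \<longlonglongrightarrow> y_C' s"
    by (simp add: y_C'_def o_def)
qed

lemma y_C_continuous: "continuous_on {0..} (y_C \<Lambda>)"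
  by (rule DERIV_continuous_on[OF y_C_has_derivative]) simp

lemma y_C_bij: "bij_betw (y_C \<Lambda>) {0..} {0..<1}"
  unfolding bij_betw_def
proof
  show "inj_on (y_C \<Lambda>) {0..}"
  proof (rule inj_onI)
    fix s t assume "s \<in> {0..}" "t \<in> {0..}" "y_C \<Lambda> s = y_C \<Lambda> t"
    then show "s = t" using y_C_less_iff[of s t] y_C_less_iff[of t s] by simp
  qed
  have "y_C \<Lambda> s \<in> {0..<1}" if "0 \<le> s" for s
    using that y_C_less_one y_C_strict_mono[of 0 s] y_C_zero by (cases "s = 0") auto
  moreover have "y \<in> y_C \<Lambda> ` {0..}" if y: "y \<in> {0..<1}" for y
  proof -
    have "\<forall>\<^sub>F s in at_top. y < y_C \<Lambda> s \<and> 0 \<le> s"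
      using y by (intro eventually_conj order_tendstoD(1)[OF y_C_tendsto_one] eventually_ge_at_top) simp
    then obtain b where b: "y < y_C \<Lambda> b" "0 \<le> b"
      using eventually_happens'[OF trivial_limit_at_top_linorder] by blast
    have "\<exists>s. 0 \<le> s \<and> s \<le> b \<and> y_C \<Lambda> s = y"
      using y b y_C_zero by (intro IVT' continuous_on_subset[OF y_C_continuous]) auto
    then show ?thesis by auto
  qed
  ultimately show "y_C \<Lambda> ` {0..} = {0..<1}" by auto
qed

lemma t_0_nonneg: "y \<in> {0..<1} \<Longrightarrow> 0 \<le> t_0 \<Lambda> y"
  using bij_betw_apply[OF bij_betw_the_inv_into[OF y_C_bij], of y] unfolding t_0_def by simp

lemma y_C_t_0: "y \<in> {0..<1} \<Longrightarrow> y_C \<Lambda> (t_0 \<Lambda> y) = y"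
  using f_the_inv_into_f_bij_betw[OF y_C_bij] unfolding t_0_def by blast

lemma t_0_less_iff: "y \<in> {0..<1} \<Longrightarrow> 0 \<le> s \<Longrightarrow> t_0 \<Lambda> y < s \<longleftrightarrow> y < y_C \<Lambda> s"
  using y_C_less_iff[of "t_0 \<Lambda> y" s] by (simp add: t_0_nonneg y_C_t_0)

lemma less_t_0_iff: "y \<in> {0..<1} \<Longrightarrow> 0 \<le> s \<Longrightarrow> s < t_0 \<Lambda> y \<longleftrightarrow> y_C \<Lambda> s < y"
  using y_C_less_iff[of s "t_0 \<Lambda> y"] by (simp add: t_0_nonneg y_C_t_0)

text \<open>Both order relations transfer through the strictly increasing \<open>y_C\<close>, so open rays pull
  back to open rays.\<close>

lemma t_0_continuous: "continuous_on {0..<1} (t_0 \<Lambda>)"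
  unfolding continuous_on_def
proof (intro ballI order_tendstoI)
  fix y :: real assume y: "y \<in> {0..<1}"
  have mem: "\<forall>\<^sub>F z in at y within {0..<1}. z \<in> {0..<1}"
    by (simp add: eventually_at_filter)
  show "\<forall>\<^sub>F z in at y within {0..<1}. s < t_0 \<Lambda> z" if "s < t_0 \<Lambda> y" for s
  proof (cases "0 \<le> s")
    case True
    then have "y_C \<Lambda> s < y" using that y less_t_0_iff[of y s] by simp
    from order_tendstoD(1)[OF tendsto_ident_at this] mem show ?thesis
        by eventually_elim (simp add: less_t_0_iff True)
  next
    case False
    from mem show ?thesis 
    proof eventually_elim
      case (elim z)
      then show ?case using t_0_nonneg[of z] False by simp
    qed
  qed
  show "\<forall>\<^sub>F z in at y within {0..<1}. t_0 \<Lambda> z < s" if "t_0 \<Lambda> y < s" for s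
  proof -
    have s: "0 \<le> s" using t_0_nonneg[OF y] that by simp
    then have "y < y_C \<Lambda> s" using that y t_0_less_iff[of y s] by simp
    from order_tendstoD(2)[OF tendsto_ident_at this] mem show ?thesis
      by eventually_elim (simp add: t_0_less_iff s)
  qed
qed

lemma t_0_at_top: "filterlim (t_0 \<Lambda>) at_top (at_left 1)"
  unfolding filterlim_at_top_ge[where c = 0]
proof (intro allI impI)
  fix Z :: real assume Z: "0 \<le> Z"
  have "max 0 (y_C \<Lambda> Z) < 1" using y_C_less_one[OF Z] by simp
  from eventually_at_left_real[OF this] show "\<forall>\<^sub>F y in at_left 1. Z \<le> t_0 \<Lambda> y"
  proof eventually_elim
    case (elim y)
    then show ?case using less_t_0_iff[of y Z] Z by (simp add: less_imp_le)
  qed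
qed

lemma t_0_has_derivative:
  assumes y: "0 < y" "y < 1"
  shows "(t_0 \<Lambda> has_real_derivative inverse (y_C' (t_0 \<Lambda> y))) (at y)"
proof (rule DERIV_inverse_function[where f = "y_C \<Lambda>" and a = 0 and b = 1])
  have "0 < t_0 \<Lambda> y" using y less_t_0_iff[of y 0] by (simp add: y_C_zero)
  then show "(y_C \<Lambda> has_real_derivative y_C' (t_0 \<Lambda> y)) (at (t_0 \<Lambda> y))"
    using y_C_has_derivative[of "t_0 \<Lambda> y"] at_within_interior[of "t_0 \<Lambda> y" "{0..}"] by simp
  show "y_C' (t_0 \<Lambda> y) \<noteq> 0" using y_C'_pos[of "t_0 \<Lambda> y"] \<open>0 < t_0 \<Lambda> y\<close> by simp
  show "isCont (t_0 \<Lambda>) y"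
    using continuous_on_interior[OF t_0_continuous] y by simp
qed (use y in \<open>simp_all add: y_C_t_0\<close>)

end

section \<open>The double integrals\<close>

context jump_rate_distribution
begin

lemma inner_integral_time:
  assumes v: "0 < v"
  shows "(\<integral>\<^sup>+t. ennreal (indicator {T<..} t * (exp (- v * t) * v\<^sup>2)) \<partial>lborel) = ennreal (v * exp (- v * T))"
proof -
  let ?F = "\<lambda>t. - v * exp (- v * t)" and ?f = "\<lambda>t. exp (- v * t) * v\<^sup>2"
  have lim: "((\<lambda>t. - v * exp (- v * t)) \<longlongrightarrow> - v * 0) at_top"
    using v by (intro tendsto_intros filterlim_compose[OF exp_at_bot])
      (auto simp: filterlim_uminus_at_bot intro!: filterlim_tendsto_pos_mult_at_top filterlim_ident)
  have deriv: "DERIV ?F t :> ?f t" for t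
    by (auto intro!: derivative_eq_intros simp: power2_eq_square)
  have lower: "((?F \<circ> real_of_ereal) \<longlongrightarrow> ?F T) (at_right (ereal T))"
    unfolding ereal_tendsto_simps by (auto intro!: tendsto_eq_intros)
  have upper: "((?F \<circ> real_of_ereal) \<longlongrightarrow> 0) (at_left \<infinity>)"
    unfolding ereal_tendsto_simps using lim by simp
  note ftc = interval_integral_FTC_nonneg[OF _ deriv _ _ lower upper]
  have "set_integrable lborel {T<..} ?f" "(LBINT t:{T<..}. ?f t) = v * exp (- v * T)"
    using ftc by (auto simp: interval_lebesgue_integral_def)
  then have int: "integrable lborel (\<lambda>t. indicator {T<..} t * ?f t)"
    and eq: "(LINT t|lborel. indicator {T<..} t * ?f t) = v * exp (- v * T)"
    unfolding set_integrable_def set_lebesgue_integral_def real_scaleR_def .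
  show ?thesis
    using nn_integral_eq_integral[OF int] unfolding eq by simp
qed

text \<open>By \<open>t_0_has_derivative\<close> the integrand is the derivative of \<open>- v exp (- v t_0 y)\<close>. This
  primitive vanishes as \<open>y\<close> tends to \<open>1\<close>, where \<open>t_0\<close> tends to infinity, so the fundamental theorem of calculus
  gives the value without a change of variables.\<close>

lemma inner_integral_position:
  assumes v: "0 < v" and x: "0 \<le> x" "x < 1"
  shows "(\<integral>\<^sup>+y. ennreal (indicator {x<..<1} y * (v * (v * exp (- v * t_0 \<Lambda> y) / y_C' (t_0 \<Lambda> y)))) \<partial>lborel) =
    ennreal (v * exp (- v * t_0 \<Lambda> x))"
proof -
  let ?F = "\<lambda>y. - v * exp (- v * t_0 \<Lambda> y)"
  let ?f = "\<lambda>y. v * (v * exp (- v * t_0 \<Lambda> y) / y_C' (t_0 \<Lambda> y))"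
  have lim: "((\<lambda>y. - v * exp (- v * t_0 \<Lambda> y)) \<longlongrightarrow> - v * 0) (at_left 1)"
    using v by (intro tendsto_intros filterlim_compose[OF exp_at_bot])
      (auto simp: filterlim_uminus_at_bot intro!: filterlim_tendsto_pos_mult_at_top t_0_at_top)
  have cont: "continuous_on {0..<1} ?F"
    by (intro continuous_intros t_0_continuous)
  have deriv_cont: "continuous_on {0..<1} (\<lambda>y. y_C' (t_0 \<Lambda> y))"
    by (rule continuous_on_compose2[OF y_C'_continuous t_0_continuous]) (use t_0_nonneg in auto)
  have deriv_nz: "y_C' (t_0 \<Lambda> y) \<noteq> 0" if "y \<in> {0..<1}" for y
    using y_C'_pos[OF t_0_nonneg[OF that]] by simp
  have deriv: "DERIV ?F y :> ?f y" and cont_f: "isCont ?f y"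
    if "ereal x < ereal y" "ereal y < ereal 1" for y
  proof -
    have y: "0 < y" "y < 1" using that x by auto
    show "DERIV ?F y :> ?f y"
      by (auto intro!: derivative_eq_intros t_0_has_derivative y simp: divide_inverse)
    have "continuous_on {0..<1} ?f"
      using deriv_nz by (intro continuous_intros t_0_continuous deriv_cont) auto
    then show "isCont ?f y"
      using continuous_on_interior[of "{0..<1}" ?f y] y by simp
  qed
  have nonneg: "0 \<le> ?f y" if "x < y" "y < 1" for y
  proof -
    have "0 < y_C' (t_0 \<Lambda> y)" using x that by (intro y_C'_pos t_0_nonneg) auto
    then show ?thesis using v by simp
  qed
  then have AE_nonneg: "AE y in lborel. ereal x < ereal y \<longrightarrow> ereal y < ereal 1 \<longrightarrow> 0 \<le> ?f y"
    by simp
  have "(?F \<longlongrightarrow> ?F x) (at x within {0..<1})"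
    using cont x by (auto simp: continuous_on_def)
  then have "(?F \<longlongrightarrow> ?F x) (at x within {x..(x + 1) / 2})"
    by (rule tendsto_within_subset) (use x in auto)
  then have lower: "((?F \<circ> real_of_ereal) \<longlongrightarrow> ?F x) (at_right (ereal x))"
    unfolding ereal_tendsto_simps using x by (simp add: at_within_Icc_at_right)
  have upper: "((?F \<circ> real_of_ereal) \<longlongrightarrow> 0) (at_left (ereal 1))"
    unfolding ereal_tendsto_simps using lim by simp
  note ftc = interval_integral_FTC_nonneg[OF _ deriv cont_f AE_nonneg lower upper]
  have "set_integrable lborel {x<..<1} ?f" "(LBINT y:{x<..<1}. ?f y) = v * exp (- v * t_0 \<Lambda> x)"
    using ftc x by (simp_all add: interval_lebesgue_integral_def)
  then have int: "integrable lborel (\<lambda>y. indicator {x<..<1} y * ?f y)"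
    and eq: "(LINT y|lborel. indicator {x<..<1} y * ?f y) = v * exp (- v * t_0 \<Lambda> x)"
    unfolding set_integrable_def set_lebesgue_integral_def real_scaleR_def .
  have "0 \<le> indicator {x<..<1} y * ?f y" for y
    using nonneg[of y] by (auto simp: indicator_def)
  then show ?thesis
    using nn_integral_eq_integral[OF int] unfolding eq by simp
qed

lemma nn_integral_times_exp:
  assumes "0 \<le> s"
  shows "(\<integral>\<^sup>+v. ennreal (v * exp (- v * s)) \<partial>\<Lambda>) = ennreal (y_C' s)"
  unfolding y_C'_def using assms
  by (intro nn_integral_eq_integral integrable_times_exp) (use rates_pos in \<open>auto elim!: eventually_mono\<close>)

lemma time_integral:
  assumes T: "0 \<le> T"
  shows "(LINT p:({0..} \<times> {T<..})|(\<Lambda> \<Otimes>\<^sub>M lborel). exp (- fst p * snd p) * (fst p)\<^sup>2) = y_C' T"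
proof -
  let ?g = "\<lambda>p. indicator ({0..} \<times> {T<..}) p * (exp (- fst p * snd p) * (fst p)\<^sup>2) :: real"
  have S: "{0..} \<times> {T<..} \<in> sets (\<Lambda> \<Otimes>\<^sub>M lborel)" by (intro pair_measureI) auto
  have g [measurable]: "?g \<in> borel_measurable (\<Lambda> \<Otimes>\<^sub>M lborel)"
    by (intro borel_measurable_times borel_measurable_indicator S) measurable
  have "(LINT p:({0..} \<times> {T<..})|(\<Lambda> \<Otimes>\<^sub>M lborel). exp (- fst p * snd p) * (fst p)\<^sup>2) =
      enn2real (\<integral>\<^sup>+p. ennreal (?g p) \<partial>(\<Lambda> \<Otimes>\<^sub>M lborel))"
    unfolding set_lebesgue_integral_def real_scaleR_def by (intro integral_eq_nn_integral g) auto
  also have "(\<integral>\<^sup>+p. ennreal (?g p) \<partial>(\<Lambda> \<Otimes>\<^sub>M lborel)) = (\<integral>\<^sup>+v. \<integral>\<^sup>+t. ennreal (?g (v, t)) \<partial>lborel \<partial>\<Lambda>)"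
    by (intro lborel.nn_integral_fst[symmetric]) measurable
  also have "\<dots> = (\<integral>\<^sup>+v. ennreal (v * exp (- v * T)) \<partial>\<Lambda>)"
  proof (intro nn_integral_cong_AE)
    show "AE v in \<Lambda>. (\<integral>\<^sup>+t. ennreal (?g (v, t)) \<partial>lborel) = ennreal (v * exp (- v * T))"
      using rates_pos
    proof eventually_elim
      case (elim v)
      then have "?g (v, t) = indicator {T<..} t * (exp (- v * t) * v\<^sup>2)" for t
        by (simp add: indicator_def)
      then show ?case by (simp only: inner_integral_time[OF elim])
    qed
  qed
  also note nn_integral_times_exp[OF T]
  finally show ?thesis
    using y_C'_pos[OF T] by simp
qed

lemma mu_inf_integral:
  assumes x: "0 \<le> x" "x < 1"
  shows "(LINT p:({0..} \<times> {x<..<1})|mu_inf \<Lambda>. fst p) = y_C' (t_0 \<Lambda> x)"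
proof -
  let ?A = "restrict_space \<Lambda> {0..}" and ?B = "restrict_space lborel {0..<1::real}"
  let ?g = "\<lambda>p. indicator ({0..} \<times> {x<..<1}) p * fst p :: real"
  let ?h = "\<lambda>(v, y). ennreal (v * exp (- v * t_0 \<Lambda> y) / (LINT u:{0..}|\<Lambda>. u * exp (- u * t_0 \<Lambda> y)))"
  interpret B: sigma_finite_measure ?B
    by (rule sigma_finite_measure_restrict_space) (auto intro: lborel.sigma_finite_measure_axioms)
  have t0 [measurable]: "t_0 \<Lambda> \<in> borel_measurable ?B"
    using borel_measurable_continuous_on_restrict[OF t_0_continuous]
    by (simp cong: measurable_cong_sets add: sets_restrict_space)
  have deriv_cont: "continuous_on {0..<1} (\<lambda>y. y_C' (t_0 \<Lambda> y))"
    by (rule continuous_on_compose2[OF y_C'_continuous t_0_continuous]) (use t_0_nonneg in auto)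
  have Dt0 [measurable]: "(\<lambda>y. y_C' (t_0 \<Lambda> y)) \<in> borel_measurable ?B"
    using borel_measurable_continuous_on_restrict[OF deriv_cont]
    by (simp cong: measurable_cong_sets add: sets_restrict_space)
  have y_C'_eq: "(LINT u:{0..}|\<Lambda>. u * exp (- u * s)) = y_C' s" for s
    by (simp add: y_C'_def set_integral_nonneg_reals)
  have [measurable]: "(\<lambda>v. v) \<in> borel_measurable ?A" "(\<lambda>y. y) \<in> borel_measurable ?B"
    by (auto intro: measurable_restrict_space1)
  have h [measurable]: "?h \<in> borel_measurable (?A \<Otimes>\<^sub>M ?B)"
    unfolding y_C'_eq by measurable
  have S: "{0..} \<times> {x<..<1} \<in> sets (?A \<Otimes>\<^sub>M ?B)"
    using x by (intro pair_measureI) (auto simp: sets_restrict_space_iff)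
  have "fst \<in> borel_measurable (?A \<Otimes>\<^sub>M ?B)"
    using measurable_compose[OF measurable_fst, of "\<lambda>v. v" ?A borel ?B] by simp
  then have g [measurable]: "?g \<in> borel_measurable (?A \<Otimes>\<^sub>M ?B)"
    by (intro borel_measurable_times borel_measurable_indicator[OF S])
  have g': "?g \<in> borel_measurable (mu_inf \<Lambda>)"
    using g unfolding mu_inf_def by simp
  have "(LINT p:({0..} \<times> {x<..<1})|mu_inf \<Lambda>. fst p) = enn2real (\<integral>\<^sup>+p. ennreal (?g p) \<partial>mu_inf \<Lambda>)"
    unfolding set_lebesgue_integral_def real_scaleR_def
    by (intro integral_eq_nn_integral g') (auto simp: indicator_def)
  also have "(\<integral>\<^sup>+p. ennreal (?g p) \<partial>mu_inf \<Lambda>) = (\<integral>\<^sup>+p. ?h p * ennreal (?g p) \<partial>(?A \<Otimes>\<^sub>M ?B))"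
    unfolding mu_inf_def by (intro nn_integral_density h) measurable
  also have "\<dots> = (\<integral>\<^sup>+v. \<integral>\<^sup>+y. ?h (v, y) * ennreal (?g (v, y)) \<partial>?B \<partial>?A)"
    by (intro B.nn_integral_fst[symmetric]) measurable
  also have "\<dots> = (\<integral>\<^sup>+v. (\<integral>\<^sup>+y. ?h (v, y) * ennreal (?g (v, y)) \<partial>?B) * indicator {0..} v \<partial>\<Lambda>)"
    by (simp add: nn_integral_restrict_space)
  also have "\<dots> = (\<integral>\<^sup>+v. ennreal (v * exp (- v * t_0 \<Lambda> x)) \<partial>\<Lambda>)"
  proof (intro nn_integral_cong_AE)
    show "AE v in \<Lambda>. (\<integral>\<^sup>+y. ?h (v, y) * ennreal (?g (v, y)) \<partial>?B) * indicator {0..} v =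
        ennreal (v * exp (- v * t_0 \<Lambda> x))"
      using rates_pos
    proof eventually_elim
      case (elim v)
      have "(\<integral>\<^sup>+y. ?h (v, y) * ennreal (?g (v, y)) \<partial>?B) =
          (\<integral>\<^sup>+y. ?h (v, y) * ennreal (?g (v, y)) * indicator {0..<1} y \<partial>lborel)"
        by (simp add: nn_integral_restrict_space)
      also have "\<dots> = (\<integral>\<^sup>+y. ennreal (indicator {x<..<1} y *
          (v * (v * exp (- v * t_0 \<Lambda> y) / y_C' (t_0 \<Lambda> y)))) \<partial>lborel)"
      proof (intro nn_integral_cong)
        fix y
        show "?h (v, y) * ennreal (?g (v, y)) * indicator {0..<1} y = ennreal (indicator {x<..<1} y *
            (v * (v * exp (- v * t_0 \<Lambda> y) / y_C' (t_0 \<Lambda> y))))"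
        proof (cases "y \<in> {x<..<1}")
          case True
          then have "0 < y_C' (t_0 \<Lambda> y)" using x by (intro y_C'_pos t_0_nonneg) auto
          then show ?thesis
            using True elim x unfolding y_C'_eq by (simp add: mult.commute flip: ennreal_mult)
        qed simp
      qed
      finally show ?case
        using inner_integral_position[OF elim x] elim by simp
    qed
  qed
  also have "\<dots> = ennreal (y_C' (t_0 \<Lambda> x))"
    using x by (intro nn_integral_times_exp t_0_nonneg) simp
  finally show ?thesis
    using y_C'_pos[OF t_0_nonneg, of x] x by simp
qed

end

section \<open>Convergence of the search cost\<close>

lemma integral_empirical:
  fixes f :: "real \<Rightarrow> real"
  assumes [measurable]: "f \<in> borel_measurable borel"
  shows "(LINT v|empirical N w. f v) = (\<Sum>i=1..N. f (w i)) / N"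
proof -
  have "w \<in> measurable (uniform_count_measure {1..N}) borel"
    by (simp add: measurable_def space_uniform_count_measure sets_uniform_count_measure)
  from integral_distr[OF this assms] show ?thesis
    by (simp add: empirical_def integral_uniform_count_measure)
qed

lemma real_distribution_empirical:
  assumes "1 \<le> N"
  shows "real_distribution (empirical N w)"
proof -
  interpret U: prob_space "uniform_count_measure {1..N}"
    using assms by (intro prob_space_uniform_count_measure) auto
  have "w \<in> measurable (uniform_count_measure {1..N}) borel"
    by (simp add: measurable_def space_uniform_count_measure sets_uniform_count_measure)
  then interpret prob_space "empirical N w"
    unfolding empirical_def by (rule U.prob_space_distr)
  show ?thesis by unfold_locales (simp_all add: empirical_def)
qed

context jump_rate_distribution
begin

context
  fixes w :: "nat \<Rightarrow> nat \<Rightarrow> real"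
  assumes conv: "weak_conv_m (\<lambda>N. empirical N (w N)) \<Lambda>"
    and conv_mean: "(\<lambda>N. LINT v|empirical N (w N). v) \<longlonglongrightarrow> (LINT v|\<Lambda>. v)"
    and w_pos: "\<And>N i. i \<in> {1..N} \<Longrightarrow> 0 < w N i"
begin

text \<open>Weak convergence only tests functions that are bounded and continuous on the whole line,
  whereas the functions of interest are so on \<open>[0, \<infinity>)\<close>. Composing with \<open>max 0\<close> repairs this and
  changes no integral, because all rates are positive.\<close>

lemma empirical_average_tendsto:
  fixes f :: "real \<Rightarrow> real"
  assumes cont: "\<And>v. isCont (\<lambda>v. f (max 0 v)) v" and bound: "\<And>v. 0 \<le> v \<Longrightarrow> \<bar>f v\<bar> \<le> B"
    and [measurable]: "f \<in> borel_measurable borel"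
  shows "(\<lambda>N. (\<Sum>i=1..N. f (w N i)) / N) \<longlonglongrightarrow> (LINT v|\<Lambda>. f v)"
proof (rule LIMSEQ_imp_Suc)
  \<comment> \<open>The index starts at \<open>Suc n\<close> because \<open>empirical 0\<close> is not a probability measure.\<close>
  have "(\<lambda>n. LINT v|empirical (Suc n) (w (Suc n)). f (max 0 v)) \<longlonglongrightarrow> (LINT v|\<Lambda>. f (max 0 v))"
  proof (rule weak_conv_imp_integral_bdd_continuous_conv)
    show "weak_conv_m (\<lambda>n. empirical (Suc n) (w (Suc n))) \<Lambda>"
      using conv unfolding weak_conv_m_def weak_conv_def by (auto intro: LIMSEQ_Suc)
    show "norm (f (max 0 v)) \<le> B" for v using bound[of "max 0 v"] by simp
  qed (auto intro: real_distribution_empirical cont real_distribution_axioms)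
  also have "(LINT v|\<Lambda>. f (max 0 v)) = (LINT v|\<Lambda>. f v)"
    by (intro integral_cong_AE) (use rates_pos in \<open>auto elim!: eventually_mono simp: max_def\<close>)
  also have "(\<lambda>n. LINT v|empirical (Suc n) (w (Suc n)). f (max 0 v)) =
      (\<lambda>n. (\<Sum>i=1..Suc n. f (w (Suc n) i)) / real (Suc n))"
  proof
    fix n
    have "(\<Sum>i=1..Suc n. f (max 0 (w (Suc n) i))) = (\<Sum>i=1..Suc n. f (w (Suc n) i))"
      using w_pos[of _ "Suc n"] by (intro sum.cong refl) (simp add: max_def less_imp_le)
    then show "(LINT v|empirical (Suc n) (w (Suc n)). f (max 0 v)) =
        (\<Sum>i=1..Suc n. f (w (Suc n) i)) / real (Suc n)"
      by (subst integral_empirical) (simp_all del: sum.cl_ivl_Suc)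
  qed
  finally show "(\<lambda>n. (\<Sum>i=1..Suc n. f (w (Suc n) i)) / real (Suc n)) \<longlonglongrightarrow> (LINT v|\<Lambda>. f v)" .
qed

lemma jumped_fraction_tendsto:
  assumes t: "0 \<le> t"
  shows "(\<lambda>N. (\<Sum>i=1..N. 1 - exp (- w N i * t)) / N) \<longlonglongrightarrow> y_C \<Lambda> t"
proof -
  have "(\<lambda>N. (\<Sum>i=1..N. 1 - exp (- w N i * t)) / N) \<longlonglongrightarrow> (LINT v|\<Lambda>. 1 - exp (- v * t))"
    using t by (intro empirical_average_tendsto[where B = 1]) (auto intro!: continuous_intros)
  also have "(LINT v|\<Lambda>. 1 - exp (- v * t)) = y_C \<Lambda> t"
    using prob_space t by (subst Bochner_Integration.integral_diff[OF _ integrable_exp]) (simp_all add: y_C_eq)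
  finally show ?thesis .
qed

text \<open>For \<open>t > 0\<close> the function \<open>v exp (- v t)\<close> is bounded by \<open>1 / t\<close>, so weak convergence
  suffices for the numerator. For the denominator, where \<open>v\<close> is unbounded, the convergence of the
  mean rates is essential.\<close>

lemma weighted_survival_tendsto:
  assumes t: "0 \<le> t"
  shows "(\<lambda>N. (\<Sum>i=1..N. w N i * exp (- w N i * t)) / (\<Sum>i=1..N. w N i)) \<longlonglongrightarrow> y_C' t / y_C' 0"
proof -
  have mean: "(\<lambda>N. (\<Sum>i=1..N. w N i) / N) \<longlonglongrightarrow> y_C' 0"
    using conv_mean by (simp add: integral_empirical y_C'_def)
  have num: "(\<lambda>N. (\<Sum>i=1..N. w N i * exp (- w N i * t)) / N) \<longlonglongrightarrow> y_C' t"
  proof (cases "t = 0")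
    case False
    with t have t: "0 < t" by simp
    have "v * exp (- v * t) \<le> 1 / t" for v
    proof -
      have "v * t \<le> exp (v * t)" using exp_ge_add_one_self[of "v * t"] by linarith
      then show ?thesis using t by (simp add: exp_minus field_simps)
    qed
    then show ?thesis
      unfolding y_C'_def
      by (intro empirical_average_tendsto[where B = "1 / t"]) (auto intro!: continuous_intros)
  qed (use mean in simp)
  have "(\<lambda>N. ((\<Sum>i=1..N. w N i * exp (- w N i * t)) / N) / ((\<Sum>i=1..N. w N i) / N)) \<longlonglongrightarrow> y_C' t / y_C' 0"
    using y_C'_pos[of 0] by (intro tendsto_divide num mean) simp
  then show ?thesis
    by (rule Lim_transform_eventually) (auto simp: eventually_sequentially intro!: exI[of _ 1])
qed

text \<open>For \<open>t < t_0 x\<close> fewer than \<open>x N\<close> items have typically jumped by time \<open>t\<close>, which gives an upper bound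
  for the probability in question; for \<open>t > t_0 x\<close> more than \<open>x N\<close> have, which gives a lower bound. Both bounds tend to
  \<open>y_C' t / y_C' 0\<close>, and then \<open>t\<close> tends to \<open>t_0 x\<close>.\<close>

lemma search_cost_tendsto:
  fixes M :: "nat \<Rightarrow> 'a measure"
  assumes process: "\<And>N. N \<ge> 1 \<Longrightarrow> stationary_ranking_process (M N) N (w N) (X N) (\<tau> N)"
    and x: "0 \<le> x" "x < 1"
  shows "(\<lambda>N. measure (M N) {\<omega> \<in> space (M N). real (search_cost N (X N) (\<tau> N) \<omega>) / real N > x})
    \<longlonglongrightarrow> y_C' (t_0 \<Lambda> x) / y_C' 0"
proof -
  define p where "p N = measure (M N) {\<omega> \<in> space (M N). real (search_cost N (X N) (\<tau> N) \<omega>) / real N > x}" for N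
  define E where "E t N = (\<Sum>i=1..N. w N i * exp (- w N i * t)) / (\<Sum>i=1..N. w N i)" for t N
  define m where "m t N = (\<Sum>i=1..N. 1 - exp (- w N i * t))" for t N
  have p: "p N = measure (M N) {\<omega> \<in> space (M N). x * N < real (search_cost N (X N) (\<tau> N) \<omega>)}"
    if "1 \<le> N" for N
    using that by (simp add: p_def pos_less_divide_eq)
  have E: "E t \<longlonglongrightarrow> y_C' t / y_C' 0" if "0 \<le> t" for t
    unfolding E_def[abs_def] by (rule weighted_survival_tendsto[OF that])
  have m: "(\<lambda>N. m t N / N) \<longlonglongrightarrow> y_C \<Lambda> t" if "0 \<le> t" for t
    unfolding m_def by (rule jumped_fraction_tendsto[OF that])
  have tail: "(\<lambda>N. exp (- 2 * d\<^sup>2 * real N)) \<longlonglongrightarrow> 0" if "0 < d" for d :: real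
  proof -
    have "(\<lambda>N. exp (- 2 * d\<^sup>2) ^ N) \<longlonglongrightarrow> 0" using that by (intro LIMSEQ_realpow_zero) auto
    then show ?thesis by (simp add: mult.commute flip: exp_of_nat_mult)
  qed
  have x01: "x \<in> {0..<1}" using x by simp
  have t0: "0 \<le> t_0 \<Lambda> x" by (rule t_0_nonneg[OF x01])
  have upper: "\<forall>\<^sub>F N in sequentially. p N < a" if t: "0 \<le> t" "t < t_0 \<Lambda> x" and a: "y_C' t / y_C' 0 < a" for t a
  proof -
    \<comment> \<open>Half of the gap is reserved for the convergence of the mean, the other half for the deviation.\<close>
    define d where "d = (x - y_C \<Lambda> t) / 2"
    have d: "0 < d" using t less_t_0_iff[OF x01 t(1)] by (simp add: d_def)
    have "(\<lambda>N. E t N + exp (- 2 * d\<^sup>2 * real N)) \<longlonglongrightarrow> y_C' t / y_C' 0 + 0"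
      by (intro tendsto_add E tail t d)
    then have "\<forall>\<^sub>F N in sequentially. E t N + exp (- 2 * d\<^sup>2 * real N) < a"
      using a by (intro order_tendstoD(2)) auto
    moreover have "\<forall>\<^sub>F N in sequentially. m t N / N < x - d"
      using d by (intro order_tendstoD(2)[OF m[OF t(1)]]) (simp add: d_def field_simps)
    ultimately show ?thesis using eventually_ge_at_top[of 1]
    proof eventually_elim
      case (elim N)
      interpret P: stationary_ranking_process "M N" N "w N" "X N" "\<tau> N" by (rule process[OF elim(3)])
      have "m t N + d * N \<le> x * N" using elim by (simp add: field_simps)
      then have "P.prob {\<omega> \<in> space (M N). x * N < real (card (P.jumped t \<omega>))} \<le>
          P.prob {\<omega> \<in> space (M N). m t N + d * N \<le> real (card (P.jumped t \<omega>))}"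
        by (intro P.finite_measure_mono) auto
      also have "\<dots> \<le> exp (- 2 * d\<^sup>2 * real N)"
        unfolding m_def using P.prob_card_jumped_upper[OF elim(3) t(1), of d] d by simp
      finally show ?case
        using P.prob_search_cost_le[OF elim(3) t(1), of "x * N"] elim by (simp add: p E_def)
    qed
  qed
  have lower: "\<forall>\<^sub>F N in sequentially. a < p N" if t: "t_0 \<Lambda> x < t" and a: "a < y_C' t / y_C' 0" for t a
  proof -
    have t': "0 \<le> t" using t t0 by simp
    define d where "d = (y_C \<Lambda> t - x) / 2"
    have d: "0 < d" using t t_0_less_iff[OF x01 t'] by (simp add: d_def)
    have "(\<lambda>N. E t N - exp (- 2 * d\<^sup>2 * real N)) \<longlonglongrightarrow> y_C' t / y_C' 0 - 0"
      by (intro tendsto_diff E tail t' d)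
    then have "\<forall>\<^sub>F N in sequentially. a < E t N - exp (- 2 * d\<^sup>2 * real N)"
      using a by (intro order_tendstoD(1)) auto
    moreover have "\<forall>\<^sub>F N in sequentially. x + d < m t N / N"
      using d by (intro order_tendstoD(1)[OF m[OF t']]) (simp add: d_def field_simps)
    ultimately show ?thesis using eventually_ge_at_top[of 1]
    proof eventually_elim
      case (elim N)
      interpret P: stationary_ranking_process "M N" N "w N" "X N" "\<tau> N" by (rule process[OF elim(3)])
      have "x * N \<le> m t N - d * N" using elim by (simp add: field_simps)
      then have "P.prob {\<omega> \<in> space (M N). real (card (P.jumped t \<omega>)) < x * N} \<le>
          P.prob {\<omega> \<in> space (M N). real (card (P.jumped t \<omega>)) \<le> m t N - d * N}"
        by (intro P.finite_measure_mono) auto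
      also have "\<dots> \<le> exp (- 2 * d\<^sup>2 * real N)"
        unfolding m_def using P.prob_card_jumped_lower[OF elim(3) t', of d] d by simp
      finally show ?case
        using P.prob_search_cost_ge[OF elim(3) t', of "x * N"] elim by (simp add: p E_def)
    qed
  qed
  have cont: "((\<lambda>t. y_C' t / y_C' 0) \<longlongrightarrow> y_C' (t_0 \<Lambda> x) / y_C' 0) (at (t_0 \<Lambda> x) within {0..})"
    using y_C'_continuous t0 y_C'_pos[of 0] by (intro tendsto_intros) (auto simp: continuous_on_def)
  have "p \<longlonglongrightarrow> y_C' (t_0 \<Lambda> x) / y_C' 0"
  proof (rule order_tendstoI)
    fix a assume a: "a < y_C' (t_0 \<Lambda> x) / y_C' 0"
    have "\<forall>\<^sub>F t in at_right (t_0 \<Lambda> x). a < y_C' t / y_C' 0 \<and> t_0 \<Lambda> x < t"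
      using t0 by (intro eventually_conj order_tendstoD(1)[OF tendsto_within_subset[OF cont] a] eventually_at_right_less) auto
    then obtain t where "a < y_C' t / y_C' 0" "t_0 \<Lambda> x < t"
      using eventually_happens'[OF trivial_limit_at_right_real] by blast
    then show "\<forall>\<^sub>F N in sequentially. a < p N" by (intro lower)
  next
    fix a assume a: "y_C' (t_0 \<Lambda> x) / y_C' 0 < a"
    show "\<forall>\<^sub>F N in sequentially. p N < a"
    \<comment> \<open>No time lies below \<open>t_0 x = 0\<close>, but then the limit is \<open>1\<close>.\<close>
    proof (cases "t_0 \<Lambda> x = 0")
      case True
      then have "1 < a" using a y_C'_pos[of 0] by simp
      show ?thesis using eventually_ge_at_top[of 1]
      proof eventually_elim
        case (elim N)
        interpret P: stationary_ranking_process "M N" N "w N" "X N" "\<tau> N" by (rule process[OF elim])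
        show ?case using \<open>1 < a\<close> P.prob_le_1 unfolding p_def by (rule le_less_trans[rotated])
      qed
    next
      case False
      then have pos: "0 < t_0 \<Lambda> x" using t0 by simp
      have "at (t_0 \<Lambda> x) within {0..} = at (t_0 \<Lambda> x)"
        using pos by (intro at_within_interior) simp
      then have "((\<lambda>t. y_C' t / y_C' 0) \<longlongrightarrow> y_C' (t_0 \<Lambda> x) / y_C' 0) (at_left (t_0 \<Lambda> x))"
        using cont by (simp add: filterlim_at_split)
      then have "\<forall>\<^sub>F t in at_left (t_0 \<Lambda> x). y_C' t / y_C' 0 < a \<and> t \<in> {0<..<t_0 \<Lambda> x}"
        using a by (intro eventually_conj order_tendstoD(2) eventually_at_left_real pos)
      then obtain t where "y_C' t / y_C' 0 < a" "0 < t" "t < t_0 \<Lambda> x"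
        using eventually_happens'[OF trivial_limit_at_left_real] by force
      then show ?thesis by (intro upper[of t]) auto
    qed
  qed
  then show ?thesis by (simp add: p_def[abs_def])
qed

end

end

theorem mainTheorem1:
  fixes M :: "nat \<Rightarrow> 'a measure"
    and w :: "nat \<Rightarrow> nat \<Rightarrow> real"
    and X :: "nat \<Rightarrow> real \<Rightarrow> 'a \<Rightarrow> (nat \<Rightarrow> nat)"
    and \<tau> :: "nat \<Rightarrow> nat \<Rightarrow> nat \<Rightarrow> 'a \<Rightarrow> real"
    and \<Lambda> :: "real measure"
    and x :: real
  assumes process: "\<And>N. N \<ge> 1 \<Longrightarrow> stationary_ranking_process (M N) N (w N) (X N) (\<tau> N)"
    and Lambda: "real_distribution \<Lambda>" "measure \<Lambda> {..<0} = 0" "measure \<Lambda> {0} = 0"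
    and Lambda_mean: "integrable \<Lambda> (\<lambda>v. v)"
    and conv: "weak_conv_m (\<lambda>N. empirical N (w N)) \<Lambda>"
    and conv_mean: "(\<lambda>N. LINT v|empirical N (w N). v) \<longlonglongrightarrow> (LINT v|\<Lambda>. v)"
    and x: "0 \<le> x" "x < 1"
  shows "((\<lambda>N. measure (M N) {\<omega> \<in> space (M N). real (search_cost N (X N) (\<tau> N) \<omega>) / real N > x})
           \<longlonglongrightarrow> (LINT p:({0..} \<times> {x<..<1})|mu_inf \<Lambda>. fst p) / (LINT v:{0..}|\<Lambda>. v))
     \<and> (LINT p:({0..} \<times> {x<..<1})|mu_inf \<Lambda>. fst p) / (LINT v:{0..}|\<Lambda>. v)
         = (LINT p:({0..} \<times> {t_0 \<Lambda> x<..})|(\<Lambda> \<Otimes>\<^sub>M lborel). exp (- fst p * snd p) * (fst p)\<^sup>2)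
             / (LINT v:{0..}|\<Lambda>. v)
     \<and> (LINT p:({0..} \<times> {t_0 \<Lambda> x<..})|(\<Lambda> \<Otimes>\<^sub>M lborel). exp (- fst p * snd p) * (fst p)\<^sup>2)
             / (LINT v:{0..}|\<Lambda>. v)
         = (LINT v:{0..}|\<Lambda>. exp (- v * t_0 \<Lambda> x) * v) / (LINT v:{0..}|\<Lambda>. v)"
proof -
  interpret real_distribution \<Lambda> by (rule Lambda(1))
  have "{..<0} \<in> null_sets \<Lambda>" "{0} \<in> null_sets \<Lambda>"
    using Lambda(2,3) by (auto simp: null_sets_def emeasure_eq_measure)
  then have "AE v in \<Lambda>. v \<notin> {..<0}" "AE v in \<Lambda>. v \<notin> {0}"
    by (simp_all only: AE_not_in)
  then have "AE v in \<Lambda>. 0 < v" by eventually_elim auto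
  then interpret jump_rate_distribution \<Lambda>
    using Lambda_mean by unfold_locales
  have w_pos: "0 < w N i" if "i \<in> {1..N}" for N i
    using that stochastic_ranking_process.rate_pos[OF stationary_ranking_process.axioms(1)[OF process]]
    by simp
  have mean: "(LINT v:{0..}|\<Lambda>. v) = y_C' 0"
    by (simp add: set_integral_nonneg_reals y_C'_def)
  have cost: "(LINT v:{0..}|\<Lambda>. exp (- v * t_0 \<Lambda> x) * v) = y_C' (t_0 \<Lambda> x)"
    by (simp add: set_integral_nonneg_reals y_C'_def mult.commute)
  have "0 \<le> t_0 \<Lambda> x" using x by (intro t_0_nonneg) simp
  then show ?thesis
    using search_cost_tendsto[OF conv conv_mean w_pos process x]
    unfolding mean cost mu_inf_integral[OF x] time_integral[OF \<open>0 \<le> t_0 \<Lambda> x\<close>] by simp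
qed

end
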